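(* There exists a complete CAT($-1$) space $X$ such that the natural map $\phi:\partial_{\mathrm{G}}X\to\partial_{\mathrm{E}}X$ is neither injective nor surjective. Also, there exists an unbounded complete CAT($-1$) space $Y$ such that $\partial_{\mathrm{G}}Y$ and $\partial_{\mathrm{E}}Y$ are both empty.
   Context: Let $(X,d)$ be a metric space and fix a basepoint $o\in X$. All the notions below are independent of $o$ up to natural identification. $\mathbb{N}=\{1,2,\dots\}$. Gromov boundary: the Gromov product is $\langle x,y\rangle_w=\frac12\left(d(x,w)+d(y,w)-d(x,y)\right)$. A Gromov sequence is a sequence $(x_n)$ in $X$ with $\langle x_m,x_n\rangle_o\to\infty$ as $m,n\to\infty$. For Gromov sequences $x=(x_n)$, $y=(y_n)$ write $(x,y)\in E$ if $\langle x_m,y_n\rangle_o\to\infty$ as $m,n\to\infty$. Let $\sim$ be the transitive closure of the reflexive symmetric relation $E$. The Gromov boundary $\partial_{\mathrm{G}}X$ is the set of $\sim$-equivalence classes of Gromov sequences in $X$. End boundary: for $n\in\mathbb{N}$ let $\bar B_n=\overline{B(o,n)}$ (not required to be compact). An end of $X$ is a sequence $(U_n)_{n\in\mathbb{N}}$ where each $U_n$ is a connected component of $X\setminus\bar B_n$ and $U_{n+1}\subset U_n$ for all $n$. The end boundary $\partial_{\mathrm{E}}X$ is the set of ends of $X$. Natural map: for $X$ complete CAT($-1$) (in particular complete CAT(0)), the well-defined map $\phi:\partial_{\mathrm{G}}X\to\partial_{\mathrm{E}}X$ sends the class of a Gromov sequence $(x_n)$ to the unique end $(U_m)$ such that for each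 $m\in\mathbb{N}$ there is $N\in\mathbb{N}$ with $x_n\in U_m$ for all $n\ge N$. *)

theory Defs
  imports "HOL-Analysis.Analysis"
begin

text \<open>Metric spaces are given by a carrier set and a distance function, as in
  \<^locale>\<open>Metric_space\<close>, so that one can quantify over them inside a formula.\<close>

definition geodesic_path :: "'a set \<Rightarrow> ('a \<Rightarrow> 'a \<Rightarrow> real) \<Rightarrow> 'a \<Rightarrow> 'a \<Rightarrow> (real \<Rightarrow> 'a) \<Rightarrow> bool" where
  "geodesic_path M d p q c \<longleftrightarrow>
     c \<in> {0..d p q} \<rightarrow> M \<and> c 0 = p \<and> c (d p q) = q \<and>
     (\<forall>s\<in>{0..d p q}. \<forall>t\<in>{0..d p q}. d (c s) (c t) = \<bar>s - t\<bar>)"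

definition geodesic_segment :: "'a set \<Rightarrow> ('a \<Rightarrow> 'a \<Rightarrow> real) \<Rightarrow> 'a \<Rightarrow> 'a \<Rightarrow> 'a set \<Rightarrow> bool" where
  "geodesic_segment M d p q S \<longleftrightarrow> (\<exists>c. geodesic_path M d p q c \<and> S = c ` {0..d p q})"

definition geodesic_space :: "'a set \<Rightarrow> ('a \<Rightarrow> 'a \<Rightarrow> real) \<Rightarrow> bool" where
  "geodesic_space M d \<longleftrightarrow>
     Metric_space M d \<and> (\<forall>p\<in>M. \<forall>q\<in>M. \<exists>c. geodesic_path M d p q c)"

text \<open>The comparison space of curvature -1 is the hyperbolic plane, in the hyperboloid model.\<close>

fun minkowski_form :: "real \<times> real \<times> real \<Rightarrow> real \<times> real \<times> real \<Rightarrow> real" where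
  "minkowski_form (x1, x2, x3) (y1, y2, y3) = x1 * y1 + x2 * y2 - x3 * y3"

definition hyp_plane :: "(real \<times> real \<times> real) set" where
  "hyp_plane = {u. minkowski_form u u = -1 \<and> snd (snd u) > 0}"

definition hyp_dist :: "real \<times> real \<times> real \<Rightarrow> real \<times> real \<times> real \<Rightarrow> real" where
  "hyp_dist u v = arcosh (- minkowski_form u v)"

definition comparison_triangle ::
  "('a \<Rightarrow> 'a \<Rightarrow> real) \<Rightarrow> 'a \<Rightarrow> 'a \<Rightarrow> 'a \<Rightarrow>
   real \<times> real \<times> real \<Rightarrow> real \<times> real \<times> real \<Rightarrow> real \<times> real \<times> real \<Rightarrow> bool" where
  "comparison_triangle d p q r p' q' r' \<longleftrightarrow>
     p' \<in> hyp_plane \<and> q' \<in> hyp_plane \<and> r' \<in> hyp_plane \<and>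
     hyp_dist p' q' = d p q \<and> hyp_dist q' r' = d q r \<and> hyp_dist r' p' = d r p"

text \<open>Pairs of a point \<open>x\<close> on a side \<open>S\<close> from \<open>p\<close> to \<open>q\<close> and its comparison point \<open>x'\<close> on the
  side from \<open>p'\<close> to \<open>q'\<close> of a comparison triangle.\<close>

definition comparison_pairs ::
  "('a \<Rightarrow> 'a \<Rightarrow> real) \<Rightarrow> 'a \<Rightarrow> 'a \<Rightarrow> 'a set \<Rightarrow> real \<times> real \<times> real \<Rightarrow> real \<times> real \<times> real \<Rightarrow>
   ('a \<times> (real \<times> real \<times> real)) set" where
  "comparison_pairs d p q S p' q' =
     {(x, x'). x \<in> S \<and> (\<exists>S'. geodesic_segment hyp_plane hyp_dist p' q' S' \<and> x' \<in> S') \<and>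
               hyp_dist p' x' = d p x}"

definition CAT_minus_1 :: "'a set \<Rightarrow> ('a \<Rightarrow> 'a \<Rightarrow> real) \<Rightarrow> bool" where
  "CAT_minus_1 M d \<longleftrightarrow>
     geodesic_space M d \<and>
     (\<forall>p q r S1 S2 S3 p' q' r'.
        geodesic_segment M d p q S1 \<and> geodesic_segment M d q r S2 \<and> geodesic_segment M d r p S3 \<and>
        comparison_triangle d p q r p' q' r' \<longrightarrow>
        (let K = comparison_pairs d p q S1 p' q' \<union> comparison_pairs d q r S2 q' r' \<union>
                 comparison_pairs d r p S3 r' p'
         in \<forall>(x, x')\<in>K. \<forall>(y, y')\<in>K. d x y \<le> hyp_dist x' y'))"

definition gromov_product :: "('a \<Rightarrow> 'a \<Rightarrow> real) \<Rightarrow> 'a \<Rightarrow> 'a \<Rightarrow> 'a \<Rightarrow> real" where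
  "gromov_product d w x y = (d x w + d y w - d x y) / 2"

definition gromov_sequences ::
  "'a set \<Rightarrow> ('a \<Rightarrow> 'a \<Rightarrow> real) \<Rightarrow> 'a \<Rightarrow> (nat \<Rightarrow> 'a) set" where
  "gromov_sequences M d w =
     {x. range x \<subseteq> M \<and>
         filterlim (\<lambda>(m, n). gromov_product d w (x m) (x n)) at_top (sequentially \<times>\<^sub>F sequentially)}"

definition gromov_E ::
  "'a set \<Rightarrow> ('a \<Rightarrow> 'a \<Rightarrow> real) \<Rightarrow> 'a \<Rightarrow> ((nat \<Rightarrow> 'a) \<times> (nat \<Rightarrow> 'a)) set" where
  "gromov_E M d w =
     {(x, y). x \<in> gromov_sequences M d w \<and> y \<in> gromov_sequences M d w \<and>
         filterlim (\<lambda>(m, n). gromov_product d w (x m) (y n)) at_top (sequentially \<times>\<^sub>F sequentially)}"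

definition gromov_boundary ::
  "'a set \<Rightarrow> ('a \<Rightarrow> 'a \<Rightarrow> real) \<Rightarrow> 'a \<Rightarrow> (nat \<Rightarrow> 'a) set set" where
  "gromov_boundary M d w = gromov_sequences M d w // (gromov_E M d w)\<^sup>+"

text \<open>The closure of the open ball, which may be smaller than \<^const>\<open>Metric_space.mcball\<close>.\<close>

definition closed_up_ball :: "'a set \<Rightarrow> ('a \<Rightarrow> 'a \<Rightarrow> real) \<Rightarrow> 'a \<Rightarrow> nat \<Rightarrow> 'a set" where
  "closed_up_ball M d w n =
     Metric_space.mtopology M d closure_of Metric_space.mball M d w (real n)"

text \<open>Ends are indexed by the positive integers; as elements of an extensional function space
  they carry no information at index 0.\<close>

definition end_boundary ::
  "'a set \<Rightarrow> ('a \<Rightarrow> 'a \<Rightarrow> real) \<Rightarrow> 'a \<Rightarrow> (nat \<Rightarrow> 'a set) set" where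
  "end_boundary M d w =
     {U \<in> \<Pi>\<^sub>E n\<in>{1..}. connected_components_of
               (subtopology (Metric_space.mtopology M d) (M - closed_up_ball M d w n)).
        \<forall>n\<ge>1. U (Suc n) \<subseteq> U n}"

text \<open>The end below exists and is unique when \<open>M\<close> is a complete CAT(-1) space and \<open>\<xi>\<close> is a point
  of its Gromov boundary.\<close>

definition natural_map ::
  "'a set \<Rightarrow> ('a \<Rightarrow> 'a \<Rightarrow> real) \<Rightarrow> 'a \<Rightarrow> (nat \<Rightarrow> 'a) set \<Rightarrow> (nat \<Rightarrow> 'a set)" where
  "natural_map M d w \<xi> =
     (THE U. U \<in> end_boundary M d w \<and> (\<forall>x\<in>\<xi>. \<forall>m\<ge>1. \<exists>N. \<forall>n\<ge>N. x n \<in> U m))"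

end

theory Submission
  imports Defs
begin

text \<open>
Both examples are regions of one space, the hyperbolic cone over the real line. Its points have polar
coordinates \<open>(r, \<theta>)\<close> with \<open>r \<ge> 0\<close> and \<open>\<theta>\<close> any real number, where angles are not read modulo \<open>2 * pi\<close>
and all points with \<open>r = 0\<close> are one point, the apex. Points whose angles differ by at most \<open>pi\<close> have
the distance of the corresponding points of the hyperbolic plane. For larger angles the geodesic
passes through the apex. The cone fails to be locally compact only at the apex. This leaves room
for an end that no boundary point reaches, and for an unbounded space with neither.

The space \<open>Y\<close> (\<open>hedgehog_rays\<close>) consists of segments that leave the apex at the angles \<open>k * pi\<close> and have
lengths \<open>k * pi\<close>. It is unbounded. Points on different segments have Gromov product \<open>0\<close> at the apex,
so a Gromov sequence would stay on one segment and be bounded. A component of the complement of a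
large ball lies on one segment, so a decreasing sequence of components dies out.

The space \<open>X\<close> (\<open>fan_and_spiral\<close>) is the union of two parts that meet only in the apex.
The fan is a hyperbolic sector of positive angle. It has many boundary points and one
end, so the natural map is not injective. The spiral is a region over the angles
\<open>\<theta> \<ge> 0\<close> that contains the points with \<open>r + 2 \<le> \<theta>\<close> and satisfies \<open>r \<le> \<theta>\<close>. The curve \<open>r + 2 = \<theta>\<close> winds
around the apex infinitely often while it moves away from it, and its tails determine an end. A
Gromov sequence keeps its angles within \<open>pi\<close> of one another from some index on, so if it stayed in
the spiral its radii would be bounded. Hence no Gromov sequence tends to this end, and the natural
map is not surjective.

The curvature bound rests on a form of Stewart's theorem. If \<open>x\<close> lies on a geodesic of length \<open>L\<close> in the
hyperbolic plane from \<open>p\<close> to \<open>q\<close>, at distance \<open>t\<close> from \<open>p\<close>, then for every point \<open>z\<close>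
\<open>sinh L * cosh d(z, x) = sinh (L - t) * cosh d(z, p) + sinh t * cosh d(z, q)\<close>,
because \<open>x\<close> is a linear combination of \<open>p\<close> and \<open>q\<close> in Minkowski space and \<open>- cosh d\<close> is the bilinear form.
A metric space in which all \<open>p\<close>, \<open>q\<close> and \<open>t\<close> admit a point \<open>x\<close> at distances \<open>t\<close> and \<open>L - t\<close>
from \<open>p\<close> and \<open>q\<close> with the inequality \<open>\<le>\<close> is CAT(-1): geodesics exist and are unique, and the comparison of two points on two
sides of a triangle follows by using the inequality twice (\<open>CAT_minus_1_if_stewart\<close>). In the cone such
points come from charts. The map to the hyperbolic plane that keeps radii and cuts off angles at
distance \<open>pi\<close> from a center \<open>c\<close> does not increase distances, and it preserves the distances to
points of angle \<open>c\<close>. Stewart's equality in the chart centered at \<open>x\<close> therefore gives the inequality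
in the cone (\<open>stewart_point_by_chart\<close>). A region inherits the property if it contains the points \<open>x\<close>,
that is, if it is convex in the sense of \<open>polar_convex\<close>.
\<close>

section \<open>The hyperbolic plane in the hyperboloid model\<close>

lemma minkowski_commute: "minkowski_form u v = minkowski_form v u"
  by (cases u; cases v) (simp add: mult.commute)

lemma minkowski_comb_right:
  "minkowski_form z (a *\<^sub>R u + b *\<^sub>R v) = a * minkowski_form z u + b * minkowski_form z v"
  by (cases u; cases v; cases z) (simp add: algebra_simps)

lemma minkowski_comb_left:
  "minkowski_form (a *\<^sub>R u + b *\<^sub>R v) z = a * minkowski_form u z + b * minkowski_form v z"
  by (simp add: minkowski_commute[of _ z] minkowski_comb_right)

text \<open>The claim reads \<open>x1 * y1 + x2 * y2 + 1 \<le> x3 * y3\<close>. The difference of the squares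
of the two sides is a sum of three squares, as in the proof of the Cauchy-Schwarz inequality.\<close>

lemma minkowski_le_minus_1:
  assumes "u \<in> hyp_plane" "v \<in> hyp_plane"
  shows "minkowski_form u v \<le> - 1"
proof -
  obtain x1 x2 x3 y1 y2 y3 where uv: "u = (x1, x2, x3)" "v = (y1, y2, y3)"
    by (metis prod_cases3)
  have x: "x3\<^sup>2 = 1 + x1\<^sup>2 + x2\<^sup>2" "x3 > 0" and y: "y3\<^sup>2 = 1 + y1\<^sup>2 + y2\<^sup>2" "y3 > 0"
    using assms by (auto simp: uv hyp_plane_def power2_eq_square)
  have "(x3 * y3)\<^sup>2 - (x1 * y1 + x2 * y2 + 1)\<^sup>2
      = (x1 - y1)\<^sup>2 + (x2 - y2)\<^sup>2 + (x1 * y2 - x2 * y1)\<^sup>2"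
    unfolding power_mult_distrib x y by (simp add: power2_eq_square algebra_simps)
  then have "(x1 * y1 + x2 * y2 + 1)\<^sup>2 \<le> (x3 * y3)\<^sup>2"
    by (smt (verit) zero_le_power2)
  then have "x1 * y1 + x2 * y2 + 1 \<le> x3 * y3"
    using x y by (meson less_eq_real_def mult_nonneg_nonneg power2_le_imp_le)
  then show ?thesis by (simp add: uv)
qed

lemma cosh_hyp_dist:
  assumes "u \<in> hyp_plane" "v \<in> hyp_plane"
  shows "cosh (hyp_dist u v) = - minkowski_form u v"
  using minkowski_le_minus_1[OF assms] by (simp add: hyp_dist_def)

lemma hyp_dist_nonneg: "u \<in> hyp_plane \<Longrightarrow> v \<in> hyp_plane \<Longrightarrow> hyp_dist u v \<ge> 0"
  using minkowski_le_minus_1 by (simp add: hyp_dist_def)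

lemma hyp_dist_commute: "hyp_dist u v = hyp_dist v u"
  by (simp add: hyp_dist_def minkowski_commute)

lemma minkowski_self: "u \<in> hyp_plane \<Longrightarrow> minkowski_form u u = - 1"
  by (simp add: hyp_plane_def)

lemma hyp_dist_eqI:
  assumes "u \<in> hyp_plane" "v \<in> hyp_plane" "0 \<le> t" "minkowski_form u v = - cosh t"
  shows "hyp_dist u v = t"
  using assms by (simp add: hyp_dist_def arcosh_cosh_real)

text \<open>The Gram matrix of three vectors is \<open>V\<^sup>T J V\<close> with \<open>det J = - 1\<close>, so minus its determinant is the
square of \<open>det V\<close>. This carries the triangle inequality below.\<close>

lemma gram_det_hyp:
  assumes "u \<in> hyp_plane" "v \<in> hyp_plane" "w \<in> hyp_plane"
  defines "A \<equiv> minkowski_form u v" and "B \<equiv> minkowski_form v w" and "C \<equiv> minkowski_form u w"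
  shows "1 - 2 * A * B * C - A\<^sup>2 - B\<^sup>2 - C\<^sup>2 \<ge> 0"
proof -
  obtain x1 x2 x3 y1 y2 y3 z1 z2 z3 where
    uvw: "u = (x1, x2, x3)" "v = (y1, y2, y3)" "w = (z1, z2, z3)"
    by (metis prod_cases3)
  have U: "- minkowski_form u u = 1" and V: "- minkowski_form v v = 1"
    and W: "- minkowski_form w w = 1"
    using assms(1-3) by (auto simp: hyp_plane_def)
  define U' V' W' where "U' = minkowski_form u u" "V' = minkowski_form v v" "W' = minkowski_form w w"
  have "- U' * V' * W' - 2 * A * B * C + A\<^sup>2 * W' + B\<^sup>2 * U' + C\<^sup>2 * V'
     = (x1 * (y2 * z3 - y3 * z2) - x2 * (y1 * z3 - y3 * z1) + x3 * (y1 * z2 - y2 * z1))\<^sup>2"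
    unfolding A_def B_def C_def U'_V'_W'_def uvw minkowski_form.simps by algebra
  moreover have "U' = -1" "V' = -1" "W' = -1" using U V W by (auto simp: U'_V'_W'_def)
  ultimately have "1 - 2 * A * B * C - A\<^sup>2 - B\<^sup>2 - C\<^sup>2
     = (x1 * (y2 * z3 - y3 * z2) - x2 * (y1 * z3 - y3 * z1) + x3 * (y1 * z2 - y2 * z1))\<^sup>2"
    by simp
  then show ?thesis by (metis zero_le_power2)
qed

lemma hyp_dist_triangle:
  assumes "u \<in> hyp_plane" "v \<in> hyp_plane" "w \<in> hyp_plane"
  shows "hyp_dist u w \<le> hyp_dist u v + hyp_dist v w"
proof -
  define a b c where "a = hyp_dist u v" "b = hyp_dist v w" "c = hyp_dist u w"
  have nn: "a \<ge> 0" "b \<ge> 0" "c \<ge> 0" using assms by (simp_all add: a_b_c_def hyp_dist_nonneg)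
  have "1 + 2 * cosh a * cosh b * cosh c - (cosh a)\<^sup>2 - (cosh b)\<^sup>2 - (cosh c)\<^sup>2 \<ge> 0"
    using gram_det_hyp[OF assms] assms by (simp add: a_b_c_def cosh_hyp_dist)
  moreover have "(sinh a * sinh b)\<^sup>2 = ((cosh a)\<^sup>2 - 1) * ((cosh b)\<^sup>2 - 1)"
    by (simp add: power_mult_distrib sinh_square_eq)
  ultimately have "(cosh c - cosh a * cosh b)\<^sup>2 \<le> (sinh a * sinh b)\<^sup>2"
    by (simp add: power2_eq_square algebra_simps)
  moreover have "sinh a * sinh b \<ge> 0" using nn by simp
  ultimately have "cosh c - cosh a * cosh b \<le> sinh a * sinh b"
    by (meson power2_le_imp_le)
  then have "cosh c \<le> cosh (a + b)" by (simp add: cosh_add)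
  then show ?thesis using nn by (simp add: cosh_real_nonneg_le_iff a_b_c_def)
qed

text \<open>The Minkowski form is positive definite on the orthogonal complement of a timelike vector.\<close>

lemma minkowski_orthogonal_null:
  assumes "p \<in> hyp_plane" "minkowski_form p v = 0" "minkowski_form v v = 0"
  shows "v = 0"
proof -
  obtain x1 x2 x3 y1 y2 y3 where uv: "p = (x1, x2, x3)" "v = (y1, y2, y3)"
    by (metis prod_cases3)
  have x: "x3\<^sup>2 = 1 + x1\<^sup>2 + x2\<^sup>2" and y: "x1 * y1 + x2 * y2 = x3 * y3" "y1\<^sup>2 + y2\<^sup>2 = y3\<^sup>2"
    using assms by (auto simp: uv hyp_plane_def power2_eq_square)
  have "(x3 * y3)\<^sup>2 + (x1 * y2 - x2 * y1)\<^sup>2 = (x3\<^sup>2 - 1) * y3\<^sup>2"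
    unfolding y(1)[symmetric] y(2)[symmetric] x by (simp add: power2_eq_square algebra_simps)
  then have "(x1 * y2 - x2 * y1)\<^sup>2 + y3\<^sup>2 = 0"
    by (simp add: power2_eq_square algebra_simps)
  then have "y3 = 0"
    by (simp add: add_nonneg_eq_0_iff)
  then show ?thesis using y(2) by (simp add: uv zero_prod_def sum_power2_eq_zero_iff)
qed

lemma hyp_dist_zero_imp_eq:
  assumes "u \<in> hyp_plane" "v \<in> hyp_plane" "hyp_dist u v = 0"
  shows "u = v"
proof -
  have uv: "minkowski_form u v = - 1" using cosh_hyp_dist[OF assms(1,2)] assms(3) by simp
  have "1 *\<^sub>R u + (-1) *\<^sub>R v = 0"
    using uv minkowski_self[OF assms(1)] minkowski_self[OF assms(2)]
    by (intro minkowski_orthogonal_null[OF assms(1)])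
      (simp_all only: minkowski_comb_right minkowski_comb_left minkowski_commute[of v u])
  then show ?thesis by simp
qed

lemma sinh_cosh_between: "sinh (L - t) * cosh t + sinh t * cosh (L - t) = sinh (L::real)"
  using sinh_add[of "L - t" t] by (simp add: mult.commute)

lemma sinh_comb_cosh: "sinh (L - t) + sinh t * cosh L = sinh (L::real) * cosh t"
  by (simp add: sinh_diff)

lemma sinh_comb_cosh': "sinh (L - t) * cosh L + sinh t = sinh (L::real) * cosh (L - t)"
  using sinh_comb_cosh[of L "L - t"] by simp

text \<open>The point \<open>x\<close> is the combination of \<open>p\<close> and \<open>q\<close> with coefficients \<open>sinh (L - t) / sinh L\<close> and
\<open>sinh t / sinh L\<close>: the difference \<open>v\<close> of the two vectors is orthogonal to \<open>p\<close> and null, hence zero. The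
claim is the bilinearity of the form.\<close>

lemma hyp_stewart:
  assumes H: "p \<in> hyp_plane" "q \<in> hyp_plane" "x \<in> hyp_plane" "z \<in> hyp_plane"
    and between: "hyp_dist p x + hyp_dist x q = hyp_dist p q"
  shows "sinh (hyp_dist p q) * cosh (hyp_dist z x)
       = sinh (hyp_dist x q) * cosh (hyp_dist z p) + sinh (hyp_dist p x) * cosh (hyp_dist z q)"
proof -
  define L t where "L = hyp_dist p q" "t = hyp_dist p x"
  have xq: "hyp_dist x q = L - t" and t: "0 \<le> t" "t \<le> L"
    using between hyp_dist_nonneg[of p x] hyp_dist_nonneg[of x q] H by (auto simp: L_t_def)
  have pq: "minkowski_form p q = - cosh L" and px: "minkowski_form p x = - cosh t"
    and qx: "minkowski_form q x = - cosh (L - t)"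
    using cosh_hyp_dist[OF H(1) H(2)] cosh_hyp_dist[OF H(1) H(3)] cosh_hyp_dist[OF H(3) H(2)] xq
    by (simp_all add: L_t_def minkowski_commute[of q x])
  define y where "y = sinh (L - t) *\<^sub>R p + sinh t *\<^sub>R q"
  define v where "v = sinh L *\<^sub>R x + (-1) *\<^sub>R y"
  note selfs = minkowski_self[OF H(1)] minkowski_self[OF H(2)] minkowski_self[OF H(3)]
  have py: "minkowski_form p y = - (sinh L * cosh t)"
    unfolding y_def minkowski_comb_right selfs pq using sinh_comb_cosh[of L t] by simp
  have qy: "minkowski_form q y = - (sinh L * cosh (L - t))"
    unfolding y_def minkowski_comb_right selfs minkowski_commute[of q p] pq
    using sinh_comb_cosh'[of L t] by simp
  have pv: "minkowski_form p v = 0" and qv: "minkowski_form q v = 0"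
    unfolding v_def minkowski_comb_right px py qx qy by auto
  have yv: "minkowski_form y v = 0"
    unfolding y_def minkowski_comb_left by (simp add: pv qv)
  have xy: "minkowski_form x y = - sinh L"
    unfolding y_def minkowski_comb_right minkowski_commute[of x p] minkowski_commute[of x q] px qx
    using sinh_cosh_between[of L t] by simp
  have xv: "minkowski_form x v = 0"
    unfolding v_def minkowski_comb_right xy selfs by simp
  have "minkowski_form v v = 0"
    using minkowski_comb_left[of "sinh L" x "-1" y v, folded v_def] xv yv by simp
  then have "v = 0" using minkowski_orthogonal_null[OF H(1) pv] by blast
  then have "minkowski_form z v = 0" by (cases z) (simp add: zero_prod_def)
  then have "sinh L * minkowski_form z x = sinh (L - t) * minkowski_form z p + sinh t * minkowski_form z q"
    unfolding v_def y_def minkowski_comb_right by simp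
  then show ?thesis
    unfolding xq L_t_def[symmetric] cosh_hyp_dist[OF H(4) H(1)] cosh_hyp_dist[OF H(4) H(2)]
      cosh_hyp_dist[OF H(4) H(3)] by simp
qed

section \<open>A criterion for CAT(-1) spaces\<close>

text \<open>In the hyperbolic plane the inequality is an equality, \<open>hyp_stewart\<close>. The upper bound is the half of it
that expresses curvature at most \<open>- 1\<close>.\<close>

definition stewart_point :: "'a set \<Rightarrow> ('a \<Rightarrow> 'a \<Rightarrow> real) \<Rightarrow> 'a \<Rightarrow> 'a \<Rightarrow> real \<Rightarrow> 'a \<Rightarrow> bool" where
  "stewart_point M d q r t m \<longleftrightarrow> m \<in> M \<and> d q m = t \<and> d m r = d q r - t \<and>
     (\<forall>p\<in>M. sinh (d q r) * cosh (d p m)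
          \<le> sinh (d q r - t) * cosh (d p q) + sinh t * cosh (d p r))"

context Metric_space begin

text \<open>The Stewart inequality at the base point \<open>p = x\<close> bounds \<open>cosh (d x m)\<close> by \<open>1\<close>. So it suffices to
find one good point for each \<open>t\<close>, and all geodesics pass through it.\<close>

lemma stewart_point_unique:
  assumes m: "stewart_point M d q r t m" and x: "x \<in> M" "d q x = t" "d x r = d q r - t"
    and "q \<in> M" "r \<in> M"
  shows "x = m"
proof (cases "d q r = 0")
  case True
  then have "d q x = 0" "d q m = 0" using x m nonneg[of q x] nonneg[of x r]
    by (auto simp: stewart_point_def)
  then show ?thesis using x m assms by (auto simp: stewart_point_def)
next
  case False
  then have L: "sinh (d q r) > 0" using nonneg[of q r] by (simp add: less_le del: nonneg)
  have "sinh (d q r) * cosh (d x m) \<le> sinh (d q r - t) * cosh (d x q) + sinh t * cosh (d x r)"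
    using m x(1) by (auto simp: stewart_point_def)
  also have "\<dots> = sinh (d q r)"
    using x by (simp add: commute[of x q] sinh_cosh_between)
  finally have "cosh (d x m) \<le> 1" using L by simp
  then have "d x m = 0" using cosh_real_ge_1[of "d x m"] cosh_real_one_iff[of "d x m"] by linarith
  then show ?thesis using x m by (auto simp: stewart_point_def)
qed

text \<open>The Stewart inequality for \<open>m\<close> at the base point \<open>m'\<close> has the value \<open>sinh L * cosh (s - t)\<close> on its
right-hand side, as for three points of a line. So the points form a geodesic.\<close>

lemma stewart_point_dist:
  assumes m: "stewart_point M d q r t m" and m': "stewart_point M d q r s m'"
    and "0 \<le> s" "s \<le> d q r" "0 \<le> t" "t \<le> d q r" "q \<in> M" "r \<in> M"
  shows "d m' m = \<bar>s - t\<bar>"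
proof (rule antisym)
  have M: "m \<in> M" "m' \<in> M" and dd: "d q m = t" "d q m' = s" "d m' r = d q r - s"
    using m m' by (auto simp: stewart_point_def)
  show "\<bar>s - t\<bar> \<le> d m' m"
    using M dd assms triangle[of q m m'] triangle[of q m' m] commute[of m m'] by (auto simp: abs_le_iff)
  show "d m' m \<le> \<bar>s - t\<bar>"
  proof (cases "d q r = 0")
    case True
    then show ?thesis using M dd assms triangle[of m' q m] commute[of q m'] by auto
  next
    case False
    then have L: "sinh (d q r) > 0" using nonneg[of q r] by (simp add: less_le del: nonneg)
    have "sinh (d q r) * cosh (d m' m)
       \<le> sinh (d q r - t) * cosh (d m' q) + sinh t * cosh (d m' r)"
      using m M by (auto simp: stewart_point_def)
    also have "\<dots> = sinh (d q r) * cosh (s - t)"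
      unfolding commute[of m' q] dd
      by (simp add: sinh_diff cosh_diff algebra_simps)
    finally have "cosh (d m' m) \<le> cosh \<bar>s - t\<bar>" using L by simp
    then show ?thesis by (subst (asm) cosh_real_nonneg_le_iff) auto
  qed
qed

end

lemma geodesic_segment_point:
  assumes "Metric_space M d" "geodesic_segment M d p q S" "x \<in> S"
  shows "p \<in> M" "q \<in> M" "x \<in> M" "d p x + d x q = d p q"
proof -
  interpret Metric_space M d by fact
  obtain c s where c: "geodesic_path M d p q c" and s: "s \<in> {0..d p q}" "x = c s"
    using assms(2,3) by (auto simp: geodesic_segment_def)
  have ends: "(0::real) \<in> {0..d p q}" "d p q \<in> {0..d p q}" by auto
  have cM: "c t \<in> M" if "t \<in> {0..d p q}" for t
    using c that unfolding geodesic_path_def Pi_iff by blast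
  show M: "p \<in> M" "q \<in> M" "x \<in> M"
    using cM[OF ends(1)] cM[OF ends(2)] cM[OF s(1)] s c unfolding geodesic_path_def by auto
  have "d (c 0) (c s) = \<bar>0 - s\<bar>" "d (c s) (c (d p q)) = \<bar>s - d p q\<bar>"
    using c s ends unfolding geodesic_path_def by blast+
  then show "d p x + d x q = d p q" using c s by (auto simp: geodesic_path_def)
qed

lemma hyp_geodesic_segment_point:
  assumes "geodesic_segment hyp_plane hyp_dist p q S" "x \<in> S"
  shows "p \<in> hyp_plane" "q \<in> hyp_plane" "x \<in> hyp_plane" "hyp_dist p x + hyp_dist x q = hyp_dist p q"
proof -
  obtain c s where c: "geodesic_path hyp_plane hyp_dist p q c"
    and s: "s \<in> {0..hyp_dist p q}" "x = c s"
    using assms by (auto simp: geodesic_segment_def)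
  then have ends: "(0::real) \<in> {0..hyp_dist p q}" "hyp_dist p q \<in> {0..hyp_dist p q}" by auto
  have cM: "c t \<in> hyp_plane" if "t \<in> {0..hyp_dist p q}" for t
    using c that unfolding geodesic_path_def Pi_iff by blast
  show "p \<in> hyp_plane" "q \<in> hyp_plane" "x \<in> hyp_plane"
    using cM[OF ends(1)] cM[OF ends(2)] cM[OF s(1)] s c unfolding geodesic_path_def by auto
  have "hyp_dist (c 0) (c s) = \<bar>0 - s\<bar>"
       "hyp_dist (c s) (c (hyp_dist p q)) = \<bar>s - hyp_dist p q\<bar>"
    using c s ends unfolding geodesic_path_def by blast+
  then show "hyp_dist p x + hyp_dist x q = hyp_dist p q"
    using c s unfolding geodesic_path_def by auto
qed

text \<open>What the comparison argument uses of a point \<open>x\<close> on a side and its comparison point \<open>x'\<close>. Unlike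
\<open>comparison_pairs\<close>, this is symmetric in the two ends of the side, so that
each pair of sides can be oriented away from the common vertex.\<close>

definition side_pair where
  "side_pair M d p q p' q' x x' \<longleftrightarrow>
     {p, q, x} \<subseteq> M \<and> {p', q', x'} \<subseteq> hyp_plane \<and> hyp_dist p' q' = d p q \<and>
     hyp_dist p' x' = d p x \<and> hyp_dist x' q' = d x q \<and> d p x + d x q = d p q"

lemma side_pair_swap:
  "Metric_space M d \<Longrightarrow> side_pair M d p q p' q' x x' \<Longrightarrow> side_pair M d q p q' p' x x'"
  unfolding side_pair_def Metric_space_def
  by (simp add: hyp_dist_commute[of q' p'] hyp_dist_commute[of q' x'] hyp_dist_commute[of x' p'] add.commute)

lemma comparison_pairs_imp_side_pair:
  assumes "Metric_space M d" "geodesic_segment M d p q S" "hyp_dist p' q' = d p q"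
    and "(x, x') \<in> comparison_pairs d p q S p' q'"
  shows "side_pair M d p q p' q' x x'"
proof -
  obtain S' where S': "geodesic_segment hyp_plane hyp_dist p' q' S'" "x' \<in> S'" "x \<in> S"
    "hyp_dist p' x' = d p x" using assms(4) by (auto simp: comparison_pairs_def)
  show ?thesis
    using geodesic_segment_point[OF assms(1,2) S'(3)] hyp_geodesic_segment_point[OF S'(1,2)]
      S'(4) assms(3) by (auto simp: side_pair_def)
qed

locale stewart_space = Metric_space +
  assumes stewart_point_exists:
    "q \<in> M \<Longrightarrow> r \<in> M \<Longrightarrow> 0 \<le> t \<Longrightarrow> t \<le> d q r \<Longrightarrow> \<exists>m. stewart_point M d q r t m"
begin

lemma stewart_at_geodesic_point:
  assumes "q \<in> M" "r \<in> M" "x \<in> M" "p \<in> M" "d q x + d x r = d q r"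
  shows "sinh (d q r) * cosh (d p x) \<le> sinh (d x r) * cosh (d p q) + sinh (d q x) * cosh (d p r)"
proof -
  have xr: "d x r = d q r - d q x" using assms(5) by simp
  then have "0 \<le> d q x" "d q x \<le> d q r" using nonneg[of x r] by auto
  then obtain m where m: "stewart_point M d q r (d q x) m"
    using stewart_point_exists assms by blast
  then have "x = m" using stewart_point_unique[OF m] assms xr by auto
  then show ?thesis using m assms xr by (auto simp: stewart_point_def)
qed

text \<open>The Stewart inequality in \<open>M\<close> and the Stewart equality in the hyperbolic plane have the same coefficients,
and these are not negative. Only upper bounds are assumed for the distances from \<open>p\<close>, because the second use
below has such a bound from the first.\<close>

lemma vertex_comparison:
  assumes x: "side_pair M d q r q' r' x x'" and p: "p \<in> M" "p' \<in> hyp_plane"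
    and le: "d p q \<le> hyp_dist p' q'" "d p r \<le> hyp_dist p' r'"
  shows "d p x \<le> hyp_dist p' x'"
proof (cases "d q r = 0")
  case True
  have nn: "d q x = 0" "q \<in> M" "x \<in> M"
    using True x nonneg[of q x] nonneg[of x r] unfolding side_pair_def by (linarith, auto)
  then have "q = x" using zero by blast
  moreover have "q' = x'" using nn x hyp_dist_zero_imp_eq by (auto simp: side_pair_def)
  ultimately show ?thesis using le by simp
next
  case False
  then have L: "sinh (d q r) > 0" using nonneg[of q r] by (simp add: less_le del: nonneg)
  have H: "q' \<in> hyp_plane" "r' \<in> hyp_plane" "x' \<in> hyp_plane" "q \<in> M" "r \<in> M" "x \<in> M"
    and eqs: "hyp_dist q' r' = d q r" "hyp_dist q' x' = d q x" "hyp_dist x' r' = d x r"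
     "d q x + d x r = d q r"
    using x by (auto simp: side_pair_def)
  have "sinh (d q r) * cosh (d p x) \<le> sinh (d x r) * cosh (d p q) + sinh (d q x) * cosh (d p r)"
    by (rule stewart_at_geodesic_point) (use H p eqs in auto)
  also have "\<dots> \<le> sinh (d x r) * cosh (hyp_dist p' q') + sinh (d q x) * cosh (hyp_dist p' r')"
    using le hyp_dist_nonneg H p
    by (intro add_mono mult_left_mono) (simp_all add: cosh_real_nonneg_le_iff order_trans[OF nonneg])
  also have "\<dots> = sinh (d q r) * cosh (hyp_dist p' x')"
    using hyp_stewart[of q' r' x' p'] H p eqs by simp
  finally show ?thesis
    using L hyp_dist_nonneg[OF p(2) H(3)] by (simp add: cosh_real_nonneg_le_iff)
qed

text \<open>The comparison of \<open>r\<close> with \<open>x\<close> bounds one of the two distances that enter the comparison of \<open>x\<close> with \<open>y\<close>.\<close>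

lemma two_sides_comparison:
  assumes x: "side_pair M d p q p' q' x x'" and y: "side_pair M d p r p' r' y y'"
    and qr: "hyp_dist q' r' = d q r"
  shows "d x y \<le> hyp_dist x' y'"
proof -
  have "d r x \<le> hyp_dist r' x'"
    by (rule vertex_comparison[OF x])
      (use y qr in \<open>auto simp: side_pair_def commute[of r] hyp_dist_commute[of r']\<close>)
  then show ?thesis
    by (intro vertex_comparison[OF y])
      (use x in \<open>auto simp: side_pair_def commute[of x] hyp_dist_commute[of x']\<close>)
qed

lemma same_side_comparison:
  assumes x: "side_pair M d p q p' q' x x'" and y: "side_pair M d p q p' q' y y'"
  shows "d x y \<le> hyp_dist x' y'"
  by (rule vertex_comparison[OF y])
    (use x in \<open>auto simp: side_pair_def commute[of x] hyp_dist_commute[of x']\<close>)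

proposition CAT_minus_1_if_stewart:
  shows "CAT_minus_1 M d"
  unfolding CAT_minus_1_def
proof (intro conjI allI impI)
  show "geodesic_space M d"
    unfolding geodesic_space_def
  proof (intro conjI ballI)
    show "Metric_space M d" by (rule Metric_space_axioms)
    fix p q assume pq: "p \<in> M" "q \<in> M"
    obtain c where c: "\<And>t. 0 \<le> t \<Longrightarrow> t \<le> d p q \<Longrightarrow> stewart_point M d p q t (c t)"
      using stewart_point_exists[OF pq] by metis
    have "c 0 = p" using c[of 0] pq by (auto simp: stewart_point_def)
    moreover have "c (d p q) = q" using c[of "d p q"] pq by (auto simp: stewart_point_def)
    moreover have "c \<in> {0..d p q} \<rightarrow> M" using c by (auto simp: stewart_point_def)
    moreover have "d (c s) (c t) = \<bar>s - t\<bar>" if "s \<in> {0..d p q}" "t \<in> {0..d p q}" for s t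
      using stewart_point_dist[OF c c, of t s] that pq by simp
    ultimately have "geodesic_path M d p q c"
      unfolding geodesic_path_def by blast
    then show "\<exists>c. geodesic_path M d p q c" by blast
  qed
next
  fix p q r S1 S2 S3 p' q' r'
  assume A: "geodesic_segment M d p q S1 \<and> geodesic_segment M d q r S2 \<and>
    geodesic_segment M d r p S3 \<and> comparison_triangle d p q r p' q' r'"
  have d: "hyp_dist p' q' = d p q" "hyp_dist q' r' = d q r" "hyp_dist r' p' = d r p"
      and d': "hyp_dist q' p' = d q p" "hyp_dist r' q' = d r q" "hyp_dist p' r' = d p r"
    using A commute[of q p] commute[of r q] commute[of p r] hyp_dist_commute[of q' p']
      hyp_dist_commute[of r' q'] hyp_dist_commute[of p' r']
    unfolding comparison_triangle_def by metis+
  note pairs = comparison_pairs_imp_side_pair[OF Metric_space_axioms]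
  define P where "P x x' \<longleftrightarrow> side_pair M d p q p' q' x x' \<or> side_pair M d q r q' r' x x' \<or>
      side_pair M d r p r' p' x x'" for x x'
  have K: "P x x'" if "(x, x') \<in> comparison_pairs d p q S1 p' q' \<union> comparison_pairs d q r S2 q' r' \<union>
                 comparison_pairs d r p S3 r' p'" for x x'
    using that A d pairs unfolding P_def by blast
  note swap = side_pair_swap[OF Metric_space_axioms]
  note two = two_sides_comparison and same = same_side_comparison
  have "d x y \<le> hyp_dist x' y'" if "P x x'" "P y y'" for x x' y y'
    using that unfolding P_def
    by (elim disjE) (blast intro: same two[OF swap _ d'(3)] two[OF _ swap d(2)] two[OF _ swap d(3)]
        two[OF swap _ d'(1)] two[OF swap _ d'(2)] two[OF _ swap d(1)])+
  then show "let K = comparison_pairs d p q S1 p' q' \<union> comparison_pairs d q r S2 q' r' \<union>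
                 comparison_pairs d r p S3 r' p'
         in \<forall>(x, x')\<in>K. \<forall>(y, y')\<in>K. d x y \<le> hyp_dist x' y'"
    unfolding Let_def using K by fast
qed

end

section \<open>The hyperbolic cone over the real line\<close>

text \<open>The hyperbolic law of cosines, with the angle at the apex cut off at \<open>pi\<close>.\<close>

definition cone_dist :: "real \<times> real \<Rightarrow> real \<times> real \<Rightarrow> real" where
  "cone_dist u v = arcosh (cosh (fst u) * cosh (fst v)
     - sinh (fst u) * sinh (fst v) * cos (min \<bar>snd u - snd v\<bar> pi))"

text \<open>The apex is represented by the single pair \<open>(0, 0)\<close>, so that distance zero implies equality.\<close>

definition hyperbolic_cone :: "(real \<times> real) set" where
  "hyperbolic_cone = insert (0, 0) {u. fst u > 0}"

definition clamp_angle :: "real \<Rightarrow> real" where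
  "clamp_angle x = max (- pi) (min pi x)"

text \<open>Polar coordinates of the hyperbolic plane around \<open>(0, 0, 1)\<close>, for angles that are measured from \<open>c\<close> and
cut off at \<open>- pi\<close> and \<open>pi\<close>.\<close>

definition cone_chart :: "real \<Rightarrow> real \<times> real \<Rightarrow> real \<times> real \<times> real" where
  "cone_chart c u = (sinh (fst u) * cos (clamp_angle (snd u - c)),
     sinh (fst u) * sin (clamp_angle (snd u - c)), cosh (fst u))"

lemma cone_arcosh_arg_ge_cosh_diff:
  fixes k :: real
  assumes "0 \<le> r" "0 \<le> s" "k \<le> 1"
  shows "cosh (r - s) \<le> cosh r * cosh s - sinh r * sinh s * k"
proof -
  have "sinh r * sinh s * k \<le> sinh r * sinh s * 1"
    using assms by (intro mult_left_mono) auto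
  then show ?thesis by (simp add: cosh_diff)
qed

lemma cone_arcosh_arg_ge_1:
  fixes k :: real
  assumes "\<bar>k\<bar> \<le> 1"
  shows "1 \<le> cosh r * cosh s - sinh r * sinh s * k"
proof -
  have "\<bar>sinh r * sinh s * k\<bar> \<le> \<bar>sinh r\<bar> * \<bar>sinh s\<bar> * 1"
    unfolding abs_mult using assms by (intro mult_left_mono) auto
  moreover have "1 \<le> cosh (\<bar>r\<bar> - \<bar>s\<bar>)" by (rule cosh_real_ge_1)
  ultimately show ?thesis by (simp add: cosh_diff)
qed

lemma cosh_cone_dist:
  "cosh (cone_dist u v) = cosh (fst u) * cosh (fst v)
     - sinh (fst u) * sinh (fst v) * cos (min \<bar>snd u - snd v\<bar> pi)"
  unfolding cone_dist_def by (intro cosh_arcosh_real cone_arcosh_arg_ge_1) simp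

lemma cone_dist_nonneg: "0 \<le> cone_dist u v"
  unfolding cone_dist_def by (intro arcosh_nonneg_real cone_arcosh_arg_ge_1) simp

lemma cone_dist_commute: "cone_dist u v = cone_dist v u"
  unfolding cone_dist_def by (simp add: abs_minus_commute mult.commute)

lemma cone_dist_eqI: "cosh (cone_dist u v) = cosh t \<Longrightarrow> 0 \<le> t \<Longrightarrow> cone_dist u v = t"
  using cone_dist_nonneg[of u v] by simp

lemma cone_dist_same_ray:
  "snd u = snd v \<Longrightarrow> cone_dist u v = \<bar>fst u - fst v\<bar>"
  by (rule cone_dist_eqI) (simp_all add: cosh_cone_dist cosh_diff)

lemma cone_dist_far_angles:
  "0 \<le> fst u \<Longrightarrow> 0 \<le> fst v \<Longrightarrow> pi \<le> \<bar>snd u - snd v\<bar> \<Longrightarrow> cone_dist u v = fst u + fst v"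
  by (rule cone_dist_eqI) (simp_all add: cosh_cone_dist cosh_add min_def)

lemma cone_dist_apex: "0 \<le> fst u \<Longrightarrow> cone_dist u (0, a) = fst u"
  by (rule cone_dist_eqI) (simp_all add: cosh_cone_dist)

lemma cone_dist_ge_radial:
  assumes "0 \<le> fst u" "0 \<le> fst v"
  shows "\<bar>fst u - fst v\<bar> \<le> cone_dist u v"
proof -
  have "cosh \<bar>fst u - fst v\<bar> \<le> cosh (cone_dist u v)"
    using cone_arcosh_arg_ge_cosh_diff[OF assms] by (simp add: cosh_cone_dist)
  then show ?thesis by (subst (asm) cosh_real_nonneg_le_iff) (auto simp: cone_dist_nonneg)
qed

lemma cone_chart_in_hyp_plane: "cone_chart c u \<in> hyp_plane"
proof -
  have "(sinh r * cos x)\<^sup>2 + (sinh r * sin x)\<^sup>2 - (cosh r)\<^sup>2 = - 1" for r x :: real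
    unfolding power_mult_distrib cosh_square_eq distrib_left[symmetric]
    using sin_cos_squared_add[of x] by (simp add: sin_squared_eq algebra_simps)
  then show ?thesis by (simp add: hyp_plane_def cone_chart_def power2_eq_square)
qed

lemma minkowski_cone_chart:
  "minkowski_form (cone_chart c u) (cone_chart c v) = sinh (fst u) * sinh (fst v) *
     cos (clamp_angle (snd u - c) - clamp_angle (snd v - c)) - cosh (fst u) * cosh (fst v)"
  by (simp add: cone_chart_def cos_diff algebra_simps)

lemma cos_clamp_diff_ge: "cos (min \<bar>x - y\<bar> pi) \<le> cos (clamp_angle x - clamp_angle y)"
proof (cases "pi \<le> \<bar>x - y\<bar>")
  case True
  then show ?thesis by (simp add: min_def cos_ge_minus_one)
next
  case False
  have "\<bar>clamp_angle x - clamp_angle y\<bar> \<le> \<bar>x - y\<bar>" by (auto simp: clamp_angle_def)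
  then have "cos \<bar>x - y\<bar> \<le> cos \<bar>clamp_angle x - clamp_angle y\<bar>"
    using False by (intro cos_monotone_0_pi_le) auto
  then show ?thesis using False by (simp add: min_def)
qed

text \<open>Cutting off angles does not increase their differences, and beyond \<open>pi\<close> a difference of angles already
counts as \<open>pi\<close> in the cone.\<close>

lemma hyp_dist_cone_chart_le:
  assumes "0 \<le> fst u" "0 \<le> fst v"
  shows "hyp_dist (cone_chart c u) (cone_chart c v) \<le> cone_dist u v"
proof -
  have "sinh (fst u) * sinh (fst v) * cos (min \<bar>snd u - snd v\<bar> pi)
      \<le> sinh (fst u) * sinh (fst v) * cos (clamp_angle (snd u - c) - clamp_angle (snd v - c))"
    using assms cos_clamp_diff_ge[of "snd u - c" "snd v - c"] by (intro mult_left_mono) auto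
  then have "cosh (hyp_dist (cone_chart c u) (cone_chart c v)) \<le> cosh (cone_dist u v)"
    by (simp add: cosh_hyp_dist cone_chart_in_hyp_plane minkowski_cone_chart cosh_cone_dist)
  then show ?thesis
    by (simp add: cosh_real_nonneg_le_iff hyp_dist_nonneg cone_chart_in_hyp_plane cone_dist_nonneg)
qed

lemma hyp_dist_cone_chart_eq:
  assumes "fst u = 0 \<or> fst v = 0 \<or> cos (clamp_angle (snd u - c) - clamp_angle (snd v - c))
     = cos (min \<bar>snd u - snd v\<bar> pi)"
  shows "hyp_dist (cone_chart c u) (cone_chart c v) = cone_dist u v"
  using assms by (auto simp: hyp_dist_def cone_dist_def minkowski_cone_chart)

lemma hyp_dist_cone_chart_center:
  assumes "fst v = 0 \<or> snd v = c"
  shows "hyp_dist (cone_chart c u) (cone_chart c v) = cone_dist u v"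
proof (rule hyp_dist_cone_chart_eq)
  have "cos (clamp_angle x) = cos (min \<bar>x\<bar> pi)" for x
    by (cases "0 \<le> x") (auto simp: clamp_angle_def min_def max_def)
  moreover have "clamp_angle 0 = 0" by (auto simp: clamp_angle_def)
  ultimately show "fst u = 0 \<or> fst v = 0 \<or> cos (clamp_angle (snd u - c) - clamp_angle (snd v - c))
     = cos (min \<bar>snd u - snd v\<bar> pi)" using assms by auto
qed

lemma hyp_dist_cone_chart_near:
  assumes "\<bar>snd u - c\<bar> \<le> pi" "\<bar>snd v - c\<bar> \<le> pi" "\<bar>snd u - snd v\<bar> \<le> pi"
  shows "hyp_dist (cone_chart c u) (cone_chart c v) = cone_dist u v"
proof -
  have "clamp_angle (snd u - c) = snd u - c" "clamp_angle (snd v - c) = snd v - c"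
    "min \<bar>snd u - snd v\<bar> pi = \<bar>snd u - snd v\<bar>"
    using assms by (auto simp: clamp_angle_def)
  then show ?thesis by (intro hyp_dist_cone_chart_eq) simp
qed

lemma in_hyperbolic_cone_nonneg: "u \<in> hyperbolic_cone \<Longrightarrow> 0 \<le> fst u"
  by (auto simp: hyperbolic_cone_def)

lemma cone_dist_zero_imp_eq:
  assumes "u \<in> hyperbolic_cone" "v \<in> hyperbolic_cone" "cone_dist u v = 0"
  shows "u = v"
proof -
  note nn = in_hyperbolic_cone_nonneg[OF assms(1)] in_hyperbolic_cone_nonneg[OF assms(2)]
  have r: "fst u = fst v" using cone_dist_ge_radial[OF nn] assms(3) by simp
  show ?thesis
  proof (cases "fst u = 0")
    case True
    then show ?thesis using r assms by (auto simp: hyperbolic_cone_def)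
  next
    case False
    have "cosh (fst v) * cosh (fst v) - sinh (fst v) * sinh (fst v) * cos (min \<bar>snd u - snd v\<bar> pi) = 1"
      using cosh_cone_dist[of u v] r assms(3) by simp
    moreover have "cosh (fst v) * cosh (fst v) = 1 + sinh (fst v) * sinh (fst v)"
      using cosh_square_eq[of "fst v"] by (simp add: power2_eq_square)
    ultimately have "cos (min \<bar>snd u - snd v\<bar> pi) = 1" using False r by (simp add: algebra_simps)
    then have "cos (min \<bar>snd u - snd v\<bar> pi) = cos 0" by simp
    then have "min \<bar>snd u - snd v\<bar> pi = 0"
      using cos_inj_pi[of "min \<bar>snd u - snd v\<bar> pi" 0] by auto
    then have "snd u = snd v" using pi_gt_zero by (auto simp: min_def split: if_splits)
    then show ?thesis using r by (simp add: prod_eq_iff)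
  qed
qed

text \<open>The triangle inequality is that of the hyperbolic plane, in the chart centered at one end of the
side to be estimated: this chart preserves that side and does not increase the other two.\<close>

interpretation cone: Metric_space hyperbolic_cone cone_dist
proof
  fix x y z assume xyz: "x \<in> hyperbolic_cone" "y \<in> hyperbolic_cone" "z \<in> hyperbolic_cone"
  note nn = xyz[THEN in_hyperbolic_cone_nonneg]
  define \<psi> where "\<psi> = cone_chart (snd z)"
  have "cone_dist x z = hyp_dist (\<psi> x) (\<psi> z)"
    unfolding \<psi>_def by (rule hyp_dist_cone_chart_center[symmetric]) simp
  also have "\<dots> \<le> hyp_dist (\<psi> x) (\<psi> y) + hyp_dist (\<psi> y) (\<psi> z)"
    unfolding \<psi>_def by (intro hyp_dist_triangle cone_chart_in_hyp_plane)
  also have "\<dots> \<le> cone_dist x y + cone_dist y z"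
    unfolding \<psi>_def using nn by (intro add_mono hyp_dist_cone_chart_le)
  finally show "cone_dist x z \<le> cone_dist x y + cone_dist y z" .
next
  fix x y assume "x \<in> hyperbolic_cone" "y \<in> hyperbolic_cone"
  then show "cone_dist x y = 0 \<longleftrightarrow> x = y"
    using cone_dist_zero_imp_eq[of x y] cone_dist_same_ray[of x x] by auto
qed (simp_all add: cone_dist_nonneg cone_dist_commute)

section \<open>Convex regions of the cone\<close>

definition cone_region :: "(real \<times> real) set \<Rightarrow> (real \<times> real) set" where
  "cone_region F = insert (0, 0) {u \<in> F. fst u > 0}"

text \<open>Convexity of \<open>cone_region F\<close> in polar coordinates. The first condition covers geodesics that run along
rays and through the apex. In the second, \<open>(\<rho>, c)\<close> is a point of the geodesic from \<open>(r, a)\<close> to \<open>(s, b)\<close>, given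
as a linear combination with coefficients \<open>\<alpha>\<close> and \<open>\<beta>\<close> of the two points in the hyperboloid model.\<close>

definition polar_convex :: "(real \<times> real) set \<Rightarrow> bool" where
  "polar_convex F \<longleftrightarrow>
     (\<forall>r a s. (r, a) \<in> F \<and> 0 < s \<and> s \<le> r \<longrightarrow> (s, a) \<in> F) \<and>
     (\<forall>r a s b \<rho> c \<alpha> \<beta>. (r, a) \<in> F \<and> (s, b) \<in> F \<and> 0 < r \<and> 0 < s \<and> 0 < \<rho> \<and>
        a \<le> c \<and> c \<le> b \<and> b < a + pi \<and> 0 \<le> \<alpha> \<and> 0 \<le> \<beta> \<and>
        sinh \<rho> * cos c = \<alpha> * (sinh r * cos a) + \<beta> * (sinh s * cos b) \<and>
        sinh \<rho> * sin c = \<alpha> * (sinh r * sin a) + \<beta> * (sinh s * sin b) \<and>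
        cosh \<rho> = \<alpha> * cosh r + \<beta> * cosh s \<longrightarrow> (\<rho>, c) \<in> F)"

lemma polar_convex_radial:
  "polar_convex F \<Longrightarrow> (r, a) \<in> F \<Longrightarrow> 0 < s \<Longrightarrow> s \<le> r \<Longrightarrow> (s, a) \<in> F"
  unfolding polar_convex_def by blast

lemma polar_convex_sector:
  assumes "polar_convex F" "(r, a) \<in> F" "(s, b) \<in> F" "0 < r" "0 < s" "0 < \<rho>"
    "a \<le> c" "c \<le> b" "b < a + pi" "0 \<le> \<alpha>" "0 \<le> \<beta>"
    "sinh \<rho> * cos c = \<alpha> * (sinh r * cos a) + \<beta> * (sinh s * cos b)"
    "sinh \<rho> * sin c = \<alpha> * (sinh r * sin a) + \<beta> * (sinh s * sin b)"
    "cosh \<rho> = \<alpha> * cosh r + \<beta> * cosh s"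
  shows "(\<rho>, c) \<in> F"
  using assms unfolding polar_convex_def by blast

lemma cone_region_subset: "cone_region F \<subseteq> hyperbolic_cone"
  by (auto simp: cone_region_def hyperbolic_cone_def)

lemma Metric_space_cone_region: "Metric_space (cone_region F) cone_dist"
  by (rule cone.subspace[OF cone_region_subset])

lemma stewart_point_swap:
  assumes "Metric_space M d" "stewart_point M d r q (d r q - t) m" "q \<in> M" "r \<in> M"
  shows "stewart_point M d q r t m"
proof -
  interpret Metric_space M d by fact
  show ?thesis
    using assms(2-4) unfolding stewart_point_def
    by (simp add: commute[of r q] commute[of m] add.commute)
qed

lemma stewart_point_start:
  assumes "Metric_space M d" "q \<in> M" "r \<in> M"
  shows "stewart_point M d q r 0 q"
proof -
  interpret Metric_space M d by fact
  show ?thesis using assms by (simp add: stewart_point_def)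
qed

text \<open>The chart centered at \<open>m\<close> preserves all distances from \<open>m\<close> and, by assumption, the distance of \<open>q\<close> and \<open>r\<close>.
It does not increase the distances of \<open>p\<close> to \<open>q\<close> and \<open>r\<close>, so Stewart's equality for the images becomes
the inequality for the points themselves. If \<open>m\<close> is the apex, any \<open>c\<close> serves as its angle.\<close>

lemma stewart_point_by_chart:
  assumes N: "N \<subseteq> hyperbolic_cone" "q \<in> N" "r \<in> N" "m \<in> N"
    and m: "fst m = 0 \<or> snd m = c"
    and L: "cone_dist q r = L" "0 < L"
    and t: "0 \<le> t" "t \<le> L"
    and qr: "hyp_dist (cone_chart c q) (cone_chart c r) = L"
    and comb: "sinh L *\<^sub>R cone_chart c m
       = sinh (L - t) *\<^sub>R cone_chart c q + sinh t *\<^sub>R cone_chart c r"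
  shows "stewart_point N cone_dist q r t m"
proof -
  define \<psi> where "\<psi> = cone_chart c"
  have H: "\<psi> u \<in> hyp_plane" for u unfolding \<psi>_def by (rule cone_chart_in_hyp_plane)
  have sL: "sinh L > 0" using L by simp
  have form_m: "sinh L * cosh (cone_dist p m)
      = sinh (L - t) * cosh (hyp_dist (\<psi> p) (\<psi> q)) + sinh t * cosh (hyp_dist (\<psi> p) (\<psi> r))" for p
  proof -
    have "sinh L * minkowski_form (\<psi> p) (\<psi> m) = minkowski_form (\<psi> p) (sinh L *\<^sub>R \<psi> m + 0 *\<^sub>R \<psi> m)"
      unfolding minkowski_comb_right by simp
    also have "\<dots> = sinh (L - t) * minkowski_form (\<psi> p) (\<psi> q) + sinh t * minkowski_form (\<psi> p) (\<psi> r)"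
      using comb by (simp add: minkowski_comb_right \<psi>_def)
    finally have "sinh L * cosh (hyp_dist (\<psi> p) (\<psi> m))
      = sinh (L - t) * cosh (hyp_dist (\<psi> p) (\<psi> q)) + sinh t * cosh (hyp_dist (\<psi> p) (\<psi> r))"
      by (simp add: cosh_hyp_dist[OF H H])
    then show ?thesis unfolding \<psi>_def by (simp only: hyp_dist_cone_chart_center[OF m])
  qed
  have self: "hyp_dist (\<psi> u) (\<psi> u) = 0" for u
    by (rule hyp_dist_eqI) (simp_all add: H minkowski_self)
  have qr': "hyp_dist (\<psi> q) (\<psi> r) = L" "hyp_dist (\<psi> r) (\<psi> q) = L"
    using qr by (simp_all add: \<psi>_def hyp_dist_commute)
  have "sinh L * cosh (cone_dist q m) = sinh L * cosh t"
    using form_m[of q] sinh_comb_cosh[of L t] by (simp add: self qr')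
  then have qm: "cone_dist q m = t" using sL t by (intro cone_dist_eqI) auto
  have "sinh L * cosh (cone_dist r m) = sinh L * cosh (L - t)"
    using form_m[of r] sinh_comb_cosh'[of L t] by (simp add: self qr')
  then have rm: "cone_dist r m = L - t" using sL t by (intro cone_dist_eqI) auto
  have "sinh L * cosh (cone_dist p m)
      \<le> sinh (L - t) * cosh (cone_dist p q) + sinh t * cosh (cone_dist p r)" if "p \<in> N" for p
  proof -
    have nn: "0 \<le> fst p" "0 \<le> fst q" "0 \<le> fst r"
      using that N by (auto intro!: in_hyperbolic_cone_nonneg)
    show ?thesis
      unfolding form_m \<psi>_def using nn t
      by (intro add_mono mult_left_mono)
        (simp_all add: cosh_real_nonneg_le_iff hyp_dist_nonneg cone_dist_nonneg
          cone_chart_in_hyp_plane hyp_dist_cone_chart_le)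
  qed
  then show ?thesis
    using qm rm L N by (simp add: stewart_point_def cone_dist_commute[of m r])
qed

text \<open>The geodesic starts at \<open>(r, a)\<close> towards the apex, and \<open>\<sigma>\<close> is the signed coordinate of \<open>u\<close> on the line
through both: positive if \<open>u\<close> lies on the same ray, negative if it lies beyond the apex. The bound
\<open>t \<le> r\<close> restricts to the part before the apex, the other part is covered by exchanging the ends.\<close>

lemma stewart_point_on_ray:
  assumes F: "polar_convex F" and q: "(r, a) \<in> cone_region F" and q2: "u \<in> cone_region F"
    and chart: "cone_chart a u = (sinh \<sigma>, 0, cosh \<sigma>)"
    and L: "cone_dist (r, a) u = r - \<sigma>"
    and t: "0 \<le> t" "t \<le> r - \<sigma>" "t \<le> r"
  shows "\<exists>m. stewart_point (cone_region F) cone_dist (r, a) u t m"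
proof (cases "t = 0")
  case True
  then show ?thesis using stewart_point_start[OF Metric_space_cone_region q q2] by blast
next
  case False
  define m where "m = (if t = r then (0, 0) else (r - t, a))"
  have "m \<in> cone_region F"
    using polar_convex_radial[OF F, of r a "r - t"] q t False
    by (auto simp: m_def cone_region_def)
  have a: "clamp_angle 0 = 0" by (auto simp: clamp_angle_def)
  have chart_m: "cone_chart a m = (sinh (r - t), 0, cosh (r - t))"
    by (auto simp: m_def cone_chart_def a)
  have chart_q: "cone_chart a (r, a) = (sinh r, 0, cosh r)" by (simp add: cone_chart_def a)
  define l where "l = r - \<sigma>"
  have \<sigma>: "\<sigma> = r - l" by (simp add: l_def)
  show ?thesis
  proof (intro exI, rule stewart_point_by_chart[OF cone_region_subset q q2])
    show "m \<in> cone_region F" by fact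
    show "fst m = 0 \<or> snd m = a" by (auto simp: m_def)
    show "cone_dist (r, a) u = l" "0 < l" "0 \<le> t" "t \<le> l" using L t False by (auto simp: l_def)
    show "hyp_dist (cone_chart a (r, a)) (cone_chart a u) = l"
      using hyp_dist_cone_chart_center[of "(r, a)" a u] L
      by (simp add: hyp_dist_commute[of "cone_chart a (r, a)"] cone_dist_commute[of u] l_def)
    show "sinh l *\<^sub>R cone_chart a m
        = sinh (l - t) *\<^sub>R cone_chart a (r, a) + sinh t *\<^sub>R cone_chart a u"
      unfolding chart_m chart_q chart \<sigma>
      by (simp add: sinh_diff cosh_diff algebra_simps)
  qed
qed

text \<open>The geodesic of the hyperbolic plane between the two points stays within the angles from \<open>a\<close> to \<open>b\<close>. Its
point at parameter \<open>t\<close> is the combination with coefficients \<open>\<alpha>\<close> and \<open>\<beta>\<close>, and the intermediate value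
theorem gives the angle \<open>c\<close> in which this point is seen.\<close>

lemma stewart_point_in_sector:
  assumes F: "polar_convex F" and q: "(r, a) \<in> cone_region F" and q2: "(s, b) \<in> cone_region F"
    and pos: "0 < r" "0 < s" and ab: "a < b" "b < a + pi"
    and t: "0 \<le> t" "t \<le> cone_dist (r, a) (s, b)"
  shows "\<exists>m. stewart_point (cone_region F) cone_dist (r, a) (s, b) t m"
proof -
  define L where "L = cone_dist (r, a) (s, b)"
  have "L \<noteq> 0" unfolding L_def
    using cone_dist_zero_imp_eq[of "(r, a)" "(s, b)"] pos ab by (auto simp: hyperbolic_cone_def)
  then have L: "0 < L"
    using cone_dist_nonneg[of "(r, a)" "(s, b)"] unfolding L_def by linarith
  then have sL: "sinh L > 0" by simp
  define \<alpha> \<beta> where "\<alpha> = sinh (L - t) / sinh L" "\<beta> = sinh t / sinh L"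
  have nn: "0 \<le> \<alpha>" "0 \<le> \<beta>" using sL t by (auto simp: \<alpha>_\<beta>_def L_def)
  \<comment> \<open>The angle \<open>c\<close> for which the second coordinate of the combination vanishes in the chart centered at \<open>c\<close>.\<close>
  have "\<exists>c. a \<le> c \<and> c \<le> b \<and>
     \<alpha> * sinh r * sin (c - a) - \<beta> * sinh s * sin (b - c) = 0"
    using ab nn pos by (intro IVT') (auto intro!: continuous_intros mult_nonneg_nonneg sin_ge_zero)
  then obtain c where c: "a \<le> c" "c \<le> b"
    and bal: "\<alpha> * sinh r * sin (c - a) = \<beta> * sinh s * sin (b - c)" by auto
  define X Z where "X = \<alpha> * sinh r * cos (c - a) + \<beta> * sinh s * cos (b - c)"
    "Z = \<alpha> * cosh r + \<beta> * cosh s"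
  have clamp: "clamp_angle (a - c) = a - c" "clamp_angle (b - c) = b - c"
    using c ab by (auto simp: clamp_angle_def)
  have cossin: "cos (a - c) = cos (c - a)" "sin (a - c) = - sin (c - a)"
    using cos_minus[of "c - a"] sin_minus[of "c - a"] by simp_all
  have XZ: "\<alpha> *\<^sub>R cone_chart c (r, a) + \<beta> *\<^sub>R cone_chart c (s, b) = (X, 0, Z)"
    using bal by (simp add: cone_chart_def clamp cossin X_Z_def)
  have qr: "hyp_dist (cone_chart c (r, a)) (cone_chart c (s, b)) = L"
    unfolding L_def using ab c by (intro hyp_dist_cone_chart_near) auto
  define V W where "V = cone_chart c (r, a)" "W = cone_chart c (s, b)"
  have VW: "V \<in> hyp_plane" "W \<in> hyp_plane" unfolding V_W_def by (rule cone_chart_in_hyp_plane)+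
  have VWf: "minkowski_form V W = - cosh L" "minkowski_form W V = - cosh L"
    using cosh_hyp_dist[OF VW] qr by (simp_all add: V_W_def minkowski_commute)
  have "sinh (L - t) * (sinh (L - t) + sinh t * cosh L) + sinh t * (sinh (L - t) * cosh L + sinh t)
     = (sinh L)\<^sup>2"
  proof -
    have "sinh (L - t) * (sinh L * cosh t) + sinh t * (sinh L * cosh (L - t))
      = sinh L * (sinh (L - t) * cosh t + sinh t * cosh (L - t))"
      by (simp add: algebra_simps)
    then show ?thesis
      unfolding sinh_comb_cosh sinh_comb_cosh' sinh_cosh_between by (simp add: power2_eq_square)
  qed
  then have unit: "\<alpha> * (\<alpha> + \<beta> * cosh L) + \<beta> * (\<alpha> * cosh L + \<beta>) = 1"
  proof -
    have "A / S * (A / S + B / S * k) + B / S * (A / S * k + B / S)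
        = (A * (A + B * k) + B * (A * k + B)) / S\<^sup>2" for A B S k :: real
      by (cases "S = 0") (simp_all add: field_simps power2_eq_square)
    then show ?thesis using sL \<open>_ = (sinh L)\<^sup>2\<close> by (simp add: \<alpha>_\<beta>_def)
  qed
  have "minkowski_form (\<alpha> *\<^sub>R V + \<beta> *\<^sub>R W) (\<alpha> *\<^sub>R V + \<beta> *\<^sub>R W) = - 1"
    unfolding minkowski_comb_right minkowski_comb_left
    using minkowski_self[OF VW(1)] minkowski_self[OF VW(2)] VWf unit
    by (simp add: algebra_simps)
  then have Z: "Z\<^sup>2 = X\<^sup>2 + 1" using XZ by (simp add: V_W_def power2_eq_square)
  \<comment> \<open>The combination lies on the ray of angle \<open>c\<close> and not on the opposite one: the multiples of \<open>X\<close> by the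
    two nonnegative numbers \<open>sin (b - c)\<close> and \<open>sin (c - a)\<close> are nonnegative and not both zero.\<close>
  have X: "X > 0"
  proof -
    have s1: "X * sin (b - c) = \<alpha> * sinh r * sin (b - a)"
    proof -
      have "X * sin (b - c) = \<alpha> * sinh r * (sin (b - c) * cos (c - a)) + (\<beta> * sinh s * sin (b - c)) * cos (b - c)"
        by (simp add: X_Z_def algebra_simps)
      also have "\<dots> = \<alpha> * sinh r * (sin (b - c) * cos (c - a) + cos (b - c) * sin (c - a))"
        unfolding bal[symmetric] by (simp add: algebra_simps)
      also have "\<dots> = \<alpha> * sinh r * sin (b - a)"
        using sin_add[of "b - c" "c - a"] by simp
      finally show ?thesis .
    qed
    have s2: "X * sin (c - a) = \<beta> * sinh s * sin (b - a)"
    proof -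
      have "X * sin (c - a) = (\<alpha> * sinh r * sin (c - a)) * cos (c - a) + \<beta> * sinh s * (cos (b - c) * sin (c - a))"
        by (simp add: X_Z_def algebra_simps)
      also have "\<dots> = \<beta> * sinh s * (sin (b - c) * cos (c - a) + cos (b - c) * sin (c - a))"
        unfolding bal by (simp add: algebra_simps)
      also have "\<dots> = \<beta> * sinh s * sin (b - a)"
        using sin_add[of "b - c" "c - a"] by simp
      finally show ?thesis .
    qed
    have "sin (b - a) > 0" "sin (b - c) \<ge> 0" "sin (c - a) \<ge> 0"
      using ab c by (auto intro!: sin_gt_zero sin_ge_zero)
    moreover have "\<alpha> > 0 \<or> \<beta> > 0" using nn unit by (cases "\<alpha> = 0"; cases "\<beta> = 0") auto
    ultimately show ?thesis
      using s1 s2 pos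
      by (smt (verit) mult_pos_pos mult_nonneg_nonneg sinh_real_pos_iff mult_nonpos_nonneg)
  qed
  define \<rho> where "\<rho> = arsinh X"
  have sinh_\<rho>: "sinh \<rho> = X" by (simp add: \<rho>_def)
  then have "\<rho> > 0" using X by (metis sinh_real_pos_iff)
  have "(cosh \<rho>)\<^sup>2 = Z\<^sup>2" using Z sinh_\<rho> by (simp add: cosh_square_eq)
  moreover have "Z \<ge> 0" using nn by (simp add: X_Z_def)
  ultimately have cosh_\<rho>: "cosh \<rho> = Z" by (simp add: power2_eq_iff_nonneg)
  have cs: "cos a = cos c * cos (c - a) + sin c * sin (c - a)"
    "sin a = sin c * cos (c - a) - cos c * sin (c - a)"
    "cos b = cos c * cos (b - c) - sin c * sin (b - c)"
    "sin b = sin c * cos (b - c) + cos c * sin (b - c)"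
    using cos_diff[of c "c - a"] sin_diff[of c "c - a"] cos_add[of c "b - c"] sin_add[of c "b - c"]
    by simp_all
  have "(\<rho>, c) \<in> F"
  proof (rule polar_convex_sector[OF F _ _ pos \<open>\<rho> > 0\<close> c ab(2) nn])
    show "(r, a) \<in> F" "(s, b) \<in> F" using q q2 pos by (auto simp: cone_region_def)
    have "\<alpha> * (sinh r * cos a) + \<beta> * (sinh s * cos b)
        = X * cos c + (\<alpha> * sinh r * sin (c - a) - \<beta> * sinh s * sin (b - c)) * sin c"
      unfolding cs X_Z_def by (simp add: algebra_simps)
    then show "sinh \<rho> * cos c = \<alpha> * (sinh r * cos a) + \<beta> * (sinh s * cos b)"
      using bal sinh_\<rho> by simp
    have "\<alpha> * (sinh r * sin a) + \<beta> * (sinh s * sin b)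
        = X * sin c - (\<alpha> * sinh r * sin (c - a) - \<beta> * sinh s * sin (b - c)) * cos c"
      unfolding cs X_Z_def by (simp add: algebra_simps)
    then show "sinh \<rho> * sin c = \<alpha> * (sinh r * sin a) + \<beta> * (sinh s * sin b)"
      using bal sinh_\<rho> by simp
    show "cosh \<rho> = \<alpha> * cosh r + \<beta> * cosh s" using cosh_\<rho> by (simp add: X_Z_def)
  qed
  then have m: "(\<rho>, c) \<in> cone_region F" using \<open>\<rho> > 0\<close> by (simp add: cone_region_def)
  have chart_m: "cone_chart c (\<rho>, c) = \<alpha> *\<^sub>R V + \<beta> *\<^sub>R W"
    using XZ sinh_\<rho> cosh_\<rho> by (simp add: cone_chart_def clamp_angle_def V_W_def)
  have "stewart_point (cone_region F) cone_dist (r, a) (s, b) t (\<rho>, c)"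
  proof (rule stewart_point_by_chart[OF cone_region_subset q q2 m _ _ L _ _ qr])
    show "sinh L *\<^sub>R cone_chart c (\<rho>, c)
        = sinh (L - t) *\<^sub>R cone_chart c (r, a) + sinh t *\<^sub>R cone_chart c (s, b)"
      unfolding chart_m using sL by (simp add: scaleR_add_right \<alpha>_\<beta>_def V_W_def)
  qed (use t in \<open>auto simp: L_def\<close>)
  then show ?thesis by blast
qed

text \<open>Two points are joined along one ray, through the apex, or inside a sector of angle less than \<open>pi\<close>. Each
of these cases is asymmetric in the ends and is completed by exchanging them.\<close>

lemma stewart_point_cone_region_exists:
  assumes F: "polar_convex F" and u: "u \<in> cone_region F" and v: "v \<in> cone_region F"
    and t: "0 \<le> t" "t \<le> cone_dist u v"
  shows "\<exists>m. stewart_point (cone_region F) cone_dist u v t m"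
proof -
  define S where "S u v t \<longleftrightarrow> (\<exists>m. stewart_point (cone_region F) cone_dist u v t m)" for u v t
  have swap: "S u v t" if "S v u (cone_dist v u - t)" "u \<in> cone_region F" "v \<in> cone_region F" for u v t
    using stewart_point_swap[OF Metric_space_cone_region] that unfolding S_def by blast
  have nn: "0 \<le> fst w" "fst w = 0 \<Longrightarrow> w = (0, 0)" if "w \<in> cone_region F" for w
    using that by (auto simp: cone_region_def)
  have c0: "clamp_angle 0 = 0" by (auto simp: clamp_angle_def)
  have apex: "S u v t"
    if "u \<in> cone_region F" "v \<in> cone_region F" "0 \<le> t" "t \<le> cone_dist u v" "fst v = 0" for u v t
  proof -
    obtain r a where ra: "u = (r, a)" by (cases u)
    have v: "v = (0, 0)" using nn that by blast
    have "cone_dist u v = r" using cone_dist_apex[of u 0] nn(1)[OF that(1)] by (simp add: v ra)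
    then show ?thesis using that stewart_point_on_ray[OF F, of r a v 0 t]
      by (auto simp: S_def v ra cone_chart_def)
  qed
  have same: "S u v t"
    if "u \<in> cone_region F" "v \<in> cone_region F" "0 \<le> t" "t \<le> cone_dist u v"
      "snd u = snd v" "fst v \<le> fst u" for u v t
  proof -
    obtain r a where ra: "u = (r, a)" by (cases u)
    have "cone_dist u v = fst u - fst v" using that by (simp add: cone_dist_same_ray)
    then show ?thesis
      using that stewart_point_on_ray[OF F, of r a v "fst v" t] nn(1)[OF that(2)]
      by (auto simp: S_def ra cone_chart_def c0)
  qed
  have far: "S u v t"
    if "u \<in> cone_region F" "v \<in> cone_region F" "0 \<le> t" "t \<le> cone_dist u v"
      "pi \<le> \<bar>snd u - snd v\<bar>" "t \<le> fst u" for u v t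
  proof -
    obtain r a where ra: "u = (r, a)" by (cases u)
    have d: "cone_dist u v = fst u + fst v" using that nn by (simp add: cone_dist_far_angles)
    have "clamp_angle (snd v - a) = pi \<or> clamp_angle (snd v - a) = - pi"
      using that(5) ra by (auto simp: clamp_angle_def min_def max_def)
    then have "cone_chart a v = (sinh (- fst v), 0, cosh (- fst v))"
      by (auto simp: cone_chart_def)
    then show ?thesis
      using that stewart_point_on_ray[OF F, of r a v "- fst v" t] d
      by (auto simp: S_def ra)
  qed
  have sector: "S u v t"
    if "u \<in> cone_region F" "v \<in> cone_region F" "0 \<le> t" "t \<le> cone_dist u v"
      "0 < fst u" "0 < fst v" "snd u < snd v" "snd v < snd u + pi" for u v t
    using that stewart_point_in_sector[OF F, of "fst u" "snd u" "fst v" "snd v" t] by (simp add: S_def)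
  have t': "0 \<le> cone_dist v u - t" "cone_dist v u - t \<le> cone_dist v u"
    using t cone_dist_commute[of u v] by auto
  note fw = u v t and bw = v u t'
  consider "fst v = 0" | "fst u = 0" | "snd u = snd v"
    | "pi \<le> \<bar>snd u - snd v\<bar>" | "0 < fst u" "0 < fst v" "snd u < snd v" "snd v < snd u + pi"
    | "0 < fst u" "0 < fst v" "snd v < snd u" "snd u < snd v + pi"
    using nn(1)[OF u] nn(1)[OF v] by (smt (verit))
  then have "S u v t"
  proof cases
    case 1 then show ?thesis using apex[OF fw] by blast
  next
    case 2 then show ?thesis using apex[OF bw] swap u v by blast
  next
    case 3
    then show ?thesis using same[OF fw] same[OF bw] swap u v by (cases "fst v \<le> fst u") auto
  next
    case 4
    then have "cone_dist v u = fst u + fst v"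
      using nn[OF u] nn[OF v] by (simp add: cone_dist_far_angles abs_minus_commute)
    then show ?thesis using 4 far[OF fw] far[OF bw] swap u v
      by (cases "t \<le> fst u") (auto simp: abs_minus_commute)
  next
    case 5 then show ?thesis using sector[OF fw] by blast
  next
    case 6 then show ?thesis using sector[OF bw] swap u v by blast
  qed
  then show ?thesis by (simp add: S_def)
qed

proposition CAT_minus_1_cone_region:
  assumes "polar_convex F"
  shows "CAT_minus_1 (cone_region F) cone_dist"
proof -
  interpret Metric_space "cone_region F" cone_dist by (rule Metric_space_cone_region)
  interpret stewart_space "cone_region F" cone_dist
    by unfold_locales (rule stewart_point_cone_region_exists[OF assms])
  show ?thesis by (rule CAT_minus_1_if_stewart)
qed

section \<open>Gromov boundaries and ends of metric spaces\<close>

lemma filterlim_double_at_top: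
  fixes f :: "nat \<Rightarrow> nat \<Rightarrow> real"
  shows "filterlim (\<lambda>(m, n). f m n) at_top (sequentially \<times>\<^sub>F sequentially)
     \<longleftrightarrow> (\<forall>C. \<exists>N. \<forall>m\<ge>N. \<forall>n\<ge>N. C \<le> f m n)"
  unfolding filterlim_at_top eventually_prod_sequentially by simp meson

lemma gromov_sequences_iff:
  "x \<in> gromov_sequences M d w \<longleftrightarrow>
     range x \<subseteq> M \<and> (\<forall>C. \<exists>N. \<forall>m\<ge>N. \<forall>n\<ge>N. C \<le> gromov_product d w (x m) (x n))"
  by (simp add: gromov_sequences_def filterlim_double_at_top)

lemma gromov_E_iff:
  "(x, y) \<in> gromov_E M d w \<longleftrightarrow> x \<in> gromov_sequences M d w \<and> y \<in> gromov_sequences M d w \<and>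
     (\<forall>C. \<exists>N. \<forall>m\<ge>N. \<forall>n\<ge>N. C \<le> gromov_product d w (x m) (y n))"
  by (simp add: gromov_E_def filterlim_double_at_top)

context Metric_space begin

lemma gromov_product_basepoint:
  assumes "w \<in> M" "w' \<in> M" "x \<in> M" "y \<in> M"
  shows "gromov_product d w x y \<le> gromov_product d w' x y + d w w'"
  using triangle[of x w' w] triangle[of y w' w] assms
  by (simp add: gromov_product_def commute[of w' w] field_simps)

lemma gromov_product_unbounded_basepoint:
  assumes "w \<in> M" "w' \<in> M" "range x \<subseteq> M" "range y \<subseteq> M"
    and "\<forall>C. \<exists>N. \<forall>m\<ge>N. \<forall>n\<ge>N. C \<le> gromov_product d w (x m) (y n)"
  shows "\<forall>C. \<exists>N. \<forall>m\<ge>N. \<forall>n\<ge>N. C \<le> gromov_product d w' (x m) (y n)"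
proof
  fix C
  obtain N where N: "\<forall>m\<ge>N. \<forall>n\<ge>N. C + d w w' \<le> gromov_product d w (x m) (y n)"
    using spec[OF assms(5), of "C + d w w'"] by (rule exE)
  have "C \<le> gromov_product d w' (x m) (y n)" if "N \<le> m" "N \<le> n" for m n
  proof -
    have "x m \<in> M" "y n \<in> M" using assms(3,4) by auto
    from gromov_product_basepoint[OF assms(1,2) this] show ?thesis
      using N that by (smt (verit))
  qed
  then show "\<exists>N. \<forall>m\<ge>N. \<forall>n\<ge>N. C \<le> gromov_product d w' (x m) (y n)"
    by (intro exI[of _ N]) simp
qed

lemma gromov_sequences_basepoint:
  assumes "w \<in> M" "w' \<in> M"
  shows "gromov_sequences M d w = gromov_sequences M d w'"
  using gromov_product_unbounded_basepoint[OF assms]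
    gromov_product_unbounded_basepoint[OF assms(2,1)]
  by (auto simp only: set_eq_iff gromov_sequences_iff) blast+

lemma gromov_E_basepoint:
  assumes "w \<in> M" "w' \<in> M"
  shows "gromov_E M d w = gromov_E M d w'"
proof -
  have "(x, y) \<in> gromov_E M d w'" if "(x, y) \<in> gromov_E M d w" "w \<in> M" "w' \<in> M" for x y w w'
  proof -
    have xy: "range x \<subseteq> M" "range y \<subseteq> M" using that by (auto simp: gromov_E_iff gromov_sequences_iff)
    show ?thesis
      using that(1) gromov_product_unbounded_basepoint[OF that(2,3) xy]
      unfolding gromov_E_iff gromov_sequences_basepoint[OF that(2,3)] by blast
  qed
  then show ?thesis using assms by auto
qed

lemma gromov_boundary_basepoint:
  assumes "w \<in> M" "w' \<in> M"
  shows "gromov_boundary M d w = gromov_boundary M d w'"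
  unfolding gromov_boundary_def gromov_sequences_basepoint[OF assms] gromov_E_basepoint[OF assms] ..

lemma gromov_boundary_elem:
  assumes "\<xi> \<in> gromov_boundary M d w"
  shows "\<xi> \<subseteq> gromov_sequences M d w" "\<xi> \<noteq> {}"
proof -
  obtain x where x: "x \<in> gromov_sequences M d w" "\<xi> = (gromov_E M d w)\<^sup>+ `` {x}"
    using assms by (auto simp: gromov_boundary_def elim: quotientE)
  have "(x, x) \<in> gromov_E M d w" using x(1) by (simp add: gromov_E_iff gromov_sequences_iff)
  then show "\<xi> \<noteq> {}" using x(2) by blast
  have "gromov_E M d w \<subseteq> gromov_sequences M d w \<times> gromov_sequences M d w"
    by (auto simp: gromov_E_iff)
  then have "(gromov_E M d w)\<^sup>+ \<subseteq> gromov_sequences M d w \<times> gromov_sequences M d w"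
    by (rule trancl_subset_Sigma)
  then show "\<xi> \<subseteq> gromov_sequences M d w" using x(2) by auto
qed

lemma closed_up_ball_subset_mcball: "closed_up_ball M d w n \<subseteq> mcball w (real n)"
  unfolding closed_up_ball_def by (intro closure_of_minimal mball_subset_mcball closedin_mcball)

lemma closed_up_ball_mono: "m \<le> n \<Longrightarrow> closed_up_ball M d w m \<subseteq> closed_up_ball M d w n"
  unfolding closed_up_ball_def by (intro closure_of_mono mball_subset_concentric) simp

lemma end_boundary_component:
  assumes "U \<in> end_boundary M d w" "1 \<le> n"
  shows "U n \<in> connected_components_of (subtopology mtopology (M - closed_up_ball M d w n))"
  using assms by (auto simp: end_boundary_def PiE_iff)

lemma end_boundary_connectedin:
  assumes "U \<in> end_boundary M d w" "1 \<le> n"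
  shows "connectedin mtopology (U n)" "U n \<noteq> {}"
proof -
  have "connectedin (subtopology mtopology (M - closed_up_ball M d w n)) (U n)"
    using connectedin_connected_components_of[OF end_boundary_component[OF assms]] .
  then show "connectedin mtopology (U n)" by (simp add: connectedin_subtopology)
  show "U n \<noteq> {}" using nonempty_connected_components_of[OF end_boundary_component[OF assms]] .
qed

lemma end_boundary_outside_ball:
  assumes "U \<in> end_boundary M d w" "1 \<le> n" "u \<in> U n" "w \<in> M"
  shows "u \<in> M" "real n \<le> d w u"
proof -
  have "U n \<subseteq> M - closed_up_ball M d w n"
    using connected_components_of_subset[OF end_boundary_component[OF assms(1,2)]] by auto
  then have u: "u \<in> M" "u \<notin> closed_up_ball M d w n" using assms by auto
  then show "u \<in> M" by simp
  have "mball w (real n) \<subseteq> closed_up_ball M d w n"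
    unfolding closed_up_ball_def by (rule closure_of_subset) auto
  then show "real n \<le> d w u" using u assms(4) by fastforce
qed

lemma end_boundary_nested:
  assumes "U \<in> end_boundary M d w" "1 \<le> m" "m \<le> n"
  shows "U n \<subseteq> U m"
  using assms(3)
proof (induction n rule: dec_induct)
  case (step k)
  then have "U (Suc k) \<subseteq> U k" using assms by (auto simp: end_boundary_def)
  then show ?case using step by blast
qed simp

lemma end_boundary_eqI:
  assumes "U \<in> end_boundary M d w" "V \<in> end_boundary M d w"
    and "\<And>n. 1 \<le> n \<Longrightarrow> U n \<inter> V n \<noteq> {}"
  shows "U = V"
proof (rule extensionalityI)
  show "U \<in> extensional {1..}" "V \<in> extensional {1..}"
    using assms by (auto simp: end_boundary_def PiE_iff)
  fix n :: nat assume "n \<in> {1..}"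
  then show "U n = V n"
    using connected_components_of_overlap[of "U n" _ "V n"] end_boundary_component assms
    by (metis atLeast_iff)
qed

text \<open>Decreasing connected sets that leave the balls around \<open>w\<close> select the components of the complements that
contain them.\<close>

lemma end_of_tails:
  assumes w: "w \<in> M"
    and K: "\<And>n. 1 \<le> n \<Longrightarrow> connectedin mtopology (K n)" "\<And>n. 1 \<le> n \<Longrightarrow> K n \<noteq> {}"
      "\<And>n. 1 \<le> n \<Longrightarrow> K (Suc n) \<subseteq> K n" "\<And>n u. 1 \<le> n \<Longrightarrow> u \<in> K n \<Longrightarrow> real n < d w u"
  shows "\<exists>U\<in>end_boundary M d w. \<forall>n\<ge>1. K n \<subseteq> U n"
proof -
  define p where "p n = (SOME x. x \<in> K n)" for n
  have p: "p n \<in> K n" if "1 \<le> n" for n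
    using K(2)[OF that] by (simp add: p_def some_in_eq)
  define T where "T n = subtopology mtopology (M - closed_up_ball M d w n)" for n
  define U where "U = (\<lambda>n\<in>{1..}. connected_component_of_set (T n) (p n))"
  have KT: "connectedin (T n) (K n)" if "1 \<le> n" for n
    using K(1,4)[OF that] connectedin_subset_topspace[OF K(1)[OF that]]
      closed_up_ball_subset_mcball[of w n]
    by (fastforce simp: T_def connectedin_subtopology)
  have KU: "K n \<subseteq> U n" if "1 \<le> n" for n
    using connected_component_of_maximal[OF KT p] that by (simp add: U_def)
  have pT: "p n \<in> topspace (T n)" if "1 \<le> n" for n
    using connectedin_subset_topspace[OF KT] p that by blast
  have "U (Suc n) \<subseteq> U n" if "1 \<le> n" for n
  proof -
    have "connectedin (T (Suc n)) (U (Suc n))"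
      by (simp add: U_def connectedin_connected_component_of)
    then have "connectedin (T n) (U (Suc n))"
      using closed_up_ball_mono[of n "Suc n" w] by (auto simp: T_def connectedin_subtopology)
    moreover have pU: "p (Suc n) \<in> U (Suc n)" using KU[of "Suc n"] p[of "Suc n"] by auto
    ultimately have "U (Suc n) \<subseteq> connected_component_of_set (T n) (p (Suc n))"
      by (rule connected_component_of_maximal)
    moreover have "p (Suc n) \<in> U n"
      using p[of "Suc n"] K(3)[OF that] KU[OF that] by auto
    then have "connected_component_of (T n) (p n) (p (Suc n))"
      using that by (simp add: U_def)
    then have "connected_component_of_set (T n) (p (Suc n)) = U n"
      using that by (simp add: U_def connected_component_of_equiv)
    ultimately show ?thesis by simp
  qed
  moreover have "U n \<in> connected_components_of (T n)" if "1 \<le> n" for n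
    using pT that by (auto simp: U_def connected_components_of_def)
  ultimately have "U \<in> end_boundary M d w"
    by (auto simp: end_boundary_def U_def T_def)
  then show ?thesis using KU by blast
qed

lemma natural_map_eqI:
  assumes V: "V \<in> end_boundary M d w" and \<xi>: "\<xi> \<noteq> {}"
    and ev: "\<And>x m. x \<in> \<xi> \<Longrightarrow> 1 \<le> m \<Longrightarrow> \<exists>N. \<forall>n\<ge>N. x n \<in> V m"
  shows "natural_map M d w \<xi> = V"
  unfolding natural_map_def
proof (rule the_equality)
  show "V \<in> end_boundary M d w \<and> (\<forall>x\<in>\<xi>. \<forall>m\<ge>1. \<exists>N. \<forall>n\<ge>N. x n \<in> V m)"
    using V ev by blast
  fix U assume U: "U \<in> end_boundary M d w \<and> (\<forall>x\<in>\<xi>. \<forall>m\<ge>1. \<exists>N. \<forall>n\<ge>N. x n \<in> U m)"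
  obtain x where x: "x \<in> \<xi>" using \<xi> by blast
  show "U = V"
  proof (rule end_boundary_eqI)
    fix m :: nat assume m: "1 \<le> m"
    obtain N1 N2 where "\<forall>n\<ge>N1. x n \<in> U m" "\<forall>n\<ge>N2. x n \<in> V m" using U ev x m by blast
    then have "x (max N1 N2) \<in> U m \<inter> V m" by simp
    then show "U m \<inter> V m \<noteq> {}" by blast
  qed (use U V in auto)
qed

end

section \<open>Topology and completeness of regions of the cone\<close>

lemma cone_dist_tendsto:
  assumes "(f \<longlongrightarrow> u) F"
  shows "((\<lambda>x. cone_dist u (f x)) \<longlongrightarrow> 0) F"
proof -
  have f: "((\<lambda>x. fst (f x)) \<longlongrightarrow> fst u) F" "((\<lambda>x. snd (f x)) \<longlongrightarrow> snd u) F"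
    by (intro tendsto_fst tendsto_snd assms)+
  have g: "((\<lambda>x. cos (min \<bar>snd u - snd (f x)\<bar> pi)) \<longlongrightarrow> cos (min \<bar>snd u - snd u\<bar> pi)) F"
    by (rule isCont_tendsto_compose[where g = "\<lambda>a. cos (min \<bar>snd u - a\<bar> pi)", OF _ f(2)])
      (intro continuous_intros)
  have "((\<lambda>x. cosh (fst u) * cosh (fst (f x))
     - sinh (fst u) * sinh (fst (f x)) * cos (min \<bar>snd u - snd (f x)\<bar> pi)) \<longlongrightarrow>
      cosh (fst u) * cosh (fst u) - sinh (fst u) * sinh (fst u) * cos (min \<bar>snd u - snd u\<bar> pi)) F"
    by (intro tendsto_mult tendsto_diff tendsto_cosh tendsto_sinh tendsto_const f g)
  also have "cosh (fst u) * cosh (fst u) - sinh (fst u) * sinh (fst u) * cos (min \<bar>snd u - snd u\<bar> pi) = 1"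
    using hyperbolic_pythagoras[of "fst u"] by (simp add: power2_eq_square min_def)
  finally have "((\<lambda>x. arcosh (cosh (fst u) * cosh (fst (f x))
     - sinh (fst u) * sinh (fst (f x)) * cos (min \<bar>snd u - snd (f x)\<bar> pi))) \<longlongrightarrow> arcosh 1) F"
    by (rule tendsto_arcosh_strong) (auto intro!: always_eventually cone_arcosh_arg_ge_1)
  then show ?thesis by (simp add: cone_dist_def)
qed

text \<open>Euclidean convergence of coordinates implies convergence in the cone, so the identity is
continuous from the plane to the region.\<close>

lemma connectedin_cone_region:
  assumes "K \<subseteq> cone_region F" "connected K"
  shows "connectedin (Metric_space.mtopology (cone_region F) cone_dist) K"
proof -
  interpret Metric_space "cone_region F" cone_dist by (rule Metric_space_cone_region)
  have "continuous_map (top_of_set K) mtopology id"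
    unfolding continuous_map_to_metric
  proof (intro ballI allI impI)
    fix u \<epsilon> assume u: "u \<in> topspace (top_of_set K)" and \<epsilon>: "(\<epsilon>::real) > 0"
    have "((\<lambda>x. cone_dist u x) \<longlongrightarrow> 0) (nhds u)"
      by (rule cone_dist_tendsto) (rule filterlim_ident)
    then have "eventually (\<lambda>x. cone_dist u x < \<epsilon>) (nhds u)"
      using \<epsilon> by (rule order_tendstoD)
    then obtain S where S: "open S" "u \<in> S" "\<forall>x\<in>S. cone_dist u x < \<epsilon>"
      by (auto simp: eventually_nhds)
    then show "\<exists>U. openin (top_of_set K) U \<and> u \<in> U \<and> (\<forall>y\<in>U. id y \<in> mball (id u) \<epsilon>)"
      using u assms(1) by (intro exI[of _ "K \<inter> S"]) (auto simp: openin_open)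
  qed
  moreover have "connectedin (top_of_set K) K"
    using assms(2) by (simp add: connectedin_subtopology)
  ultimately show ?thesis using connectedin_continuous_map_image by fastforce
qed

text \<open>At radius at least \<open>\<rho>\<close>, an angle of at least \<open>e\<close> forces \<open>cosh (cone_dist u v)\<close> to exceed \<open>1\<close> by a fixed amount.\<close>

lemma close_points_have_close_angles:
  assumes "0 < \<rho>" "0 < e"
  shows "\<exists>\<epsilon>>0. \<forall>u v. \<rho> \<le> fst u \<longrightarrow> \<rho> \<le> fst v \<longrightarrow> cone_dist u v < \<epsilon> \<longrightarrow> \<bar>snd u - snd v\<bar> < e"
proof -
  define k where "k = cos (min e pi)"
  have "k < cos 0" unfolding k_def using assms by (intro cos_monotone_0_pi) auto
  then have k: "k < 1" by simp
  define C where "C = 1 + sinh \<rho> * sinh \<rho> * (1 - k)"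
  have C: "C > 1" unfolding C_def using assms k by simp
  show ?thesis
  proof (intro exI[of _ "arcosh C"] conjI allI impI)
    show "0 < arcosh C" using C by simp
    fix u v assume uv: "\<rho> \<le> fst u" "\<rho> \<le> fst v" "cone_dist u v < arcosh C"
    show "\<bar>snd u - snd v\<bar> < e"
    proof (rule ccontr)
      assume "\<not> ?thesis"
      then have "cos (min \<bar>snd u - snd v\<bar> pi) \<le> k"
        unfolding k_def using assms by (intro cos_monotone_0_pi_le) auto
      then have "sinh \<rho> * sinh \<rho> * (1 - k)
          \<le> sinh (fst u) * sinh (fst v) * (1 - cos (min \<bar>snd u - snd v\<bar> pi))"
        using uv assms k by (intro mult_mono) auto
      moreover have "1 \<le> cosh (fst u - fst v)" by (rule cosh_real_ge_1)
      ultimately have "C \<le> cosh (cone_dist u v)"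
        by (simp add: C_def cosh_cone_dist cosh_diff algebra_simps)
      then have "cosh (arcosh C) \<le> cosh (cone_dist u v)" using C by simp
      then have "arcosh C \<le> cone_dist u v"
        using C by (simp add: cosh_real_nonneg_le_iff cone_dist_nonneg del: cosh_arcosh_real)
      then show False using uv by simp
    qed
  qed
qed

text \<open>The radii of a Cauchy sequence converge. If their limit is zero, the points tend to the apex; otherwise
the angles form a Cauchy sequence as well, and the limit of the coordinates is in \<open>F\<close>.\<close>

proposition mcomplete_cone_region:
  assumes "closed F"
  shows "Metric_space.mcomplete (cone_region F) cone_dist"
proof -
  interpret Metric_space "cone_region F" cone_dist by (rule Metric_space_cone_region)
  show ?thesis
    unfolding mcomplete_def
  proof (intro allI impI)
    fix \<sigma> assume "MCauchy \<sigma>"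
    then have C: "\<exists>N. \<forall>n\<ge>N. \<forall>n'\<ge>N. cone_dist (\<sigma> n) (\<sigma> n') < \<epsilon>" if "\<epsilon> > 0" for \<epsilon>
      using that unfolding MCauchy_def by meson
    have \<sigma>: "\<sigma> n \<in> cone_region F" for n
      using \<open>MCauchy \<sigma>\<close> unfolding MCauchy_def by auto
    have nn: "0 \<le> fst (\<sigma> n)" for n using \<sigma>[of n] by (auto simp: cone_region_def)
    have "Cauchy (\<lambda>n. fst (\<sigma> n))"
    proof (rule CauchyI)
      fix e :: real assume "0 < e"
      then obtain N where "\<forall>n\<ge>N. \<forall>n'\<ge>N. cone_dist (\<sigma> n) (\<sigma> n') < e" using C by blast
      then show "\<exists>N. \<forall>m\<ge>N. \<forall>n\<ge>N. norm (fst (\<sigma> m) - fst (\<sigma> n)) < e"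
        using cone_dist_ge_radial[OF nn nn] by (metis le_less_trans real_norm_def)
    qed
    then obtain r where r: "(\<lambda>n. fst (\<sigma> n)) \<longlonglongrightarrow> r" using Cauchy_convergent convergent_def by blast
    have "r \<ge> 0" using r nn by (simp add: LIMSEQ_le_const)
    have "\<exists>l\<in>cone_region F. (\<lambda>n. cone_dist l (\<sigma> n)) \<longlonglongrightarrow> 0"
    proof (cases "r = 0")
      case True
      have "cone_dist (0, 0) (\<sigma> n) = fst (\<sigma> n)" for n
        using cone_dist_apex[OF nn] by (simp add: cone_dist_commute[of "(0,0)"])
      then show ?thesis using r True by (intro bexI[of _ "(0, 0)"]) (auto simp: cone_region_def)
    next
      case False
      then have "r > r / 2" "r / 2 > 0" using \<open>r \<ge> 0\<close> by auto
      then obtain N0 where N0: "\<And>n. n \<ge> N0 \<Longrightarrow> r / 2 < fst (\<sigma> n)"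
        using order_tendstoD(1)[OF r \<open>r > r / 2\<close>] unfolding eventually_sequentially by blast
      have "Cauchy (\<lambda>n. snd (\<sigma> n))"
      proof (rule CauchyI)
        fix e :: real assume "0 < e"
        then obtain \<epsilon> where \<epsilon>: "\<epsilon> > 0" "\<And>u v. r / 2 \<le> fst u \<Longrightarrow> r / 2 \<le> fst v \<Longrightarrow>
            cone_dist u v < \<epsilon> \<Longrightarrow> \<bar>snd u - snd v\<bar> < e"
          using close_points_have_close_angles[OF \<open>r / 2 > 0\<close>] by blast
        obtain N where N: "\<forall>n\<ge>N. \<forall>n'\<ge>N. cone_dist (\<sigma> n) (\<sigma> n') < \<epsilon>" using C \<epsilon> by blast
        have "norm (snd (\<sigma> m) - snd (\<sigma> n)) < e" if "max N N0 \<le> m" "max N N0 \<le> n" for m n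
          using \<epsilon>(2)[of "\<sigma> m" "\<sigma> n"] N0[of m] N0[of n] N that by simp
        then show "\<exists>N. \<forall>m\<ge>N. \<forall>n\<ge>N. norm (snd (\<sigma> m) - snd (\<sigma> n)) < e" by blast
      qed
      then obtain a where a: "(\<lambda>n. snd (\<sigma> n)) \<longlonglongrightarrow> a" using Cauchy_convergent convergent_def by blast
      have lim: "\<sigma> \<longlonglongrightarrow> (r, a)" using tendsto_Pair[OF r a] by simp
      have "\<sigma> (n + N0) \<in> F" for n
        using \<sigma>[of "n + N0"] N0[of "n + N0"] \<open>r / 2 > 0\<close> by (auto simp: cone_region_def)
      then have "(r, a) \<in> F"
        using closed_sequentially[OF assms, of "\<lambda>n. \<sigma> (n + N0)"] LIMSEQ_ignore_initial_segment[OF lim]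
        by blast
      then have "(r, a) \<in> cone_region F" using \<open>r / 2 > 0\<close> by (auto simp: cone_region_def)
      then show ?thesis using cone_dist_tendsto[OF lim] by blast
    qed
    then obtain l where l: "l \<in> cone_region F" "(\<lambda>n. cone_dist l (\<sigma> n)) \<longlonglongrightarrow> 0" by blast
    have lim: "\<exists>N. \<forall>n\<ge>N. cone_dist (\<sigma> n) l < \<epsilon>" if "\<epsilon> > 0" for \<epsilon>
      using order_tendstoD(2)[OF l(2) that] by (simp add: eventually_sequentially cone_dist_commute)
    have "limitin mtopology \<sigma> l sequentially"
      unfolding limit_metric_sequentially
    proof (intro conjI allI impI)
      fix \<epsilon> :: real assume "0 < \<epsilon>"
      then obtain N where "\<forall>n\<ge>N. cone_dist (\<sigma> n) l < \<epsilon>" using lim by meson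
      then show "\<exists>N. \<forall>n\<ge>N. \<sigma> n \<in> cone_region F \<and> cone_dist (\<sigma> n) l < \<epsilon>" using \<sigma> by meson
    qed (rule l(1))
    then show "\<exists>x. limitin mtopology \<sigma> x sequentially" by (rule exI)
  qed
qed

text \<open>If the angles in \<open>T\<close> are separated from the others by at least \<open>pi\<close>, the two parts of the region meet only
in the apex. A point of radius \<open>r\<close> has distance at least \<open>r\<close> from the other part and from the apex,
so both parts are open without it.\<close>

lemma connectedin_avoiding_apex_one_side:
  assumes K: "connectedin (Metric_space.mtopology (cone_region F) cone_dist) K" "(0, 0) \<notin> K"
    and gap: "\<And>u v. u \<in> F \<Longrightarrow> v \<in> F \<Longrightarrow> 0 < fst u \<Longrightarrow> 0 < fst v \<Longrightarrow> snd u \<in> T \<Longrightarrow> snd v \<notin> T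
      \<Longrightarrow> pi \<le> \<bar>snd u - snd v\<bar>"
    and uv: "u \<in> K" "v \<in> K" "snd u \<in> T"
  shows "snd v \<in> T"
proof (rule ccontr)
  assume v: "snd v \<notin> T"
  interpret Metric_space "cone_region F" cone_dist by (rule Metric_space_cone_region)
  define E where "E S = {u \<in> F. 0 < fst u \<and> snd u \<in> S}" for S
  have op: "openin mtopology (E S)"
    if S: "\<And>u v. u \<in> E S \<Longrightarrow> v \<in> F \<Longrightarrow> 0 < fst v \<Longrightarrow> snd v \<notin> S \<Longrightarrow> pi \<le> \<bar>snd u - snd v\<bar>" for S
    unfolding openin_mtopology
  proof (intro conjI allI impI)
    show "E S \<subseteq> cone_region F" by (auto simp: E_def cone_region_def)
    fix u assume u: "u \<in> E S"
    then have "0 < fst u" by (simp add: E_def)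
    have "v \<in> E S" if "v \<in> mball u (fst u)" for v
    proof (rule ccontr)
      assume "v \<notin> E S"
      moreover have v: "v \<in> cone_region F" "cone_dist u v < fst u" using that by auto
      ultimately consider "v = (0, 0)" | "v \<in> F" "0 < fst v" "snd v \<notin> S"
        by (auto simp: E_def cone_region_def)
      then have "fst u \<le> cone_dist u v"
      proof cases
        case 1
        then show ?thesis using \<open>0 < fst u\<close> by (simp add: cone_dist_apex)
      next
        case 2
        then show ?thesis using S[OF u 2] \<open>0 < fst u\<close> by (simp add: cone_dist_far_angles)
      qed
      then show False using v by simp
    qed
    then show "\<exists>r>0. mball u r \<subseteq> E S" using \<open>0 < fst u\<close> by blast
  qed
  have op1: "openin mtopology (E T)"
    by (rule op, rule gap) (simp_all add: E_def)
  have op2: "openin mtopology (E (- T))"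
    by (rule op, subst abs_minus_commute, rule gap) (simp_all add: E_def)
  have "K \<subseteq> cone_region F" using connectedin_subset_topspace[OF K(1)] by simp
  then have sub: "K \<subseteq> E T \<union> E (- T)" using K(2) by (auto simp: E_def cone_region_def)
  show False
    by (rule connectedinD[OF K(1) op1 op2 sub]) (use uv v sub in \<open>auto simp: E_def\<close>)
qed

section \<open>Gromov sequences in regions of the cone\<close>

lemma gromov_product_cone:
  assumes "0 \<le> fst u" "0 \<le> fst v"
  shows "gromov_product cone_dist (0, 0) u v = (fst u + fst v - cone_dist u v) / 2"
  using assms by (simp add: gromov_product_def cone_dist_apex)

text \<open>For \<open>cos \<le> k < 1\<close> the law of cosines gives \<open>exp d \<ge> (1 - k) * exp (r + s) / 4\<close>, which bounds the Gromov
product at the apex.\<close>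

lemma large_gromov_product_close_angles:
  assumes "0 < e"
  shows "\<exists>C. \<forall>u v. 0 \<le> fst u \<longrightarrow> 0 \<le> fst v \<longrightarrow> C \<le> gromov_product cone_dist (0, 0) u v
     \<longrightarrow> \<bar>snd u - snd v\<bar> < e"
proof -
  define k where "k = max 0 (cos (min e pi))"
  have "cos (min e pi) < cos 0" using assms by (intro cos_monotone_0_pi) auto
  then have k: "0 \<le> k" "k < 1" "cos (min e pi) \<le> k" by (auto simp: k_def)
  show ?thesis
  proof (intro exI[of _ "ln (4 / (1 - k)) / 2 + 1"] allI impI, rule ccontr)
    fix u v assume nn: "0 \<le> fst u" "0 \<le> fst v"
      and ge: "ln (4 / (1 - k)) / 2 + 1 \<le> gromov_product cone_dist (0, 0) u v"
      and "\<not> \<bar>snd u - snd v\<bar> < e"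
    then have "cos (min \<bar>snd u - snd v\<bar> pi) \<le> cos (min e pi)"
      using assms by (intro cos_monotone_0_pi_le) auto
    then have "sinh (fst u) * sinh (fst v) * cos (min \<bar>snd u - snd v\<bar> pi)
        \<le> sinh (fst u) * sinh (fst v) * k"
      using nn k by (intro mult_left_mono) auto
    also have "\<dots> \<le> cosh (fst u) * cosh (fst v) * k"
      using nn k by (intro mult_right_mono mult_mono sinh_le_cosh_real) auto
    finally have "(1 - k) * (cosh (fst u) * cosh (fst v)) \<le> cosh (cone_dist u v)"
      by (simp add: cosh_cone_dist algebra_simps)
    moreover have "exp r / 2 \<le> cosh r" for r :: real by (simp add: cosh_field_def)
    then have "exp (fst u) / 2 * (exp (fst v) / 2) \<le> cosh (fst u) * cosh (fst v)"
      by (intro mult_mono) auto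
    then have "(1 - k) * (exp (fst u) / 2 * (exp (fst v) / 2)) \<le> (1 - k) * (cosh (fst u) * cosh (fst v))"
      using k by (intro mult_left_mono) auto
    moreover have "cosh (cone_dist u v) \<le> exp (cone_dist u v)"
      using cone_dist_nonneg[of u v] by (simp add: cosh_field_def)
    ultimately have "exp (fst u + fst v) \<le> 4 / (1 - k) * exp (cone_dist u v)"
      using k by (simp add: exp_add field_simps)
    then have "exp (fst u + fst v - cone_dist u v) \<le> 4 / (1 - k)"
      by (simp add: exp_diff divide_le_eq)
    then have "fst u + fst v - cone_dist u v \<le> ln (4 / (1 - k))"
      using k by (subst ln_ge_iff) auto
    then show False using ge nn by (simp add: gromov_product_cone)
  qed
qed

lemma apex_in_cone_region: "(0, 0) \<in> cone_region F"
  by (simp add: cone_region_def)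

lemma cone_region_nonneg: "u \<in> cone_region F \<Longrightarrow> 0 \<le> fst u"
  by (auto simp: cone_region_def)

lemma cone_dist_ge_radii_diff:
  assumes "u \<in> cone_region F" "v \<in> cone_region F"
  shows "fst v - fst u \<le> cone_dist u v"
  using cone_dist_ge_radial[OF cone_region_nonneg[OF assms(1)] cone_region_nonneg[OF assms(2)]]
  by linarith

lemma cone_dist_le_radii_sum:
  assumes "u \<in> cone_region F" "v \<in> cone_region F"
  shows "cone_dist u v \<le> fst u + fst v"
proof -
  interpret Metric_space "cone_region F" cone_dist by (rule Metric_space_cone_region)
  show ?thesis
    using triangle[OF assms(1) apex_in_cone_region assms(2)]
      cone_dist_apex[OF cone_region_nonneg[OF assms(1)]]
      cone_dist_apex[OF cone_region_nonneg[OF assms(2)]]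
    by (simp add: cone_dist_commute[of "(0, 0)" v])
qed

lemma gromov_sequences_cone_region:
  assumes "w \<in> cone_region F" "x \<in> gromov_sequences (cone_region F) cone_dist w"
  shows "\<And>n. x n \<in> cone_region F" "\<exists>N. \<forall>n\<ge>N. C \<le> fst (x n)"
    "\<exists>N. \<forall>m\<ge>N. \<forall>n\<ge>N. \<bar>snd (x m) - snd (x n)\<bar> < pi"
proof -
  interpret Metric_space "cone_region F" cone_dist by (rule Metric_space_cone_region)
  have x: "x \<in> gromov_sequences (cone_region F) cone_dist (0, 0)"
    using gromov_sequences_basepoint[OF assms(1) apex_in_cone_region] assms(2) by simp
  then show xF: "x n \<in> cone_region F" for n by (auto simp: gromov_sequences_iff)
  have gp: "\<exists>N. \<forall>m\<ge>N. \<forall>n\<ge>N. C \<le> gromov_product cone_dist (0, 0) (x m) (x n)" for C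
    using x by (simp add: gromov_sequences_iff)
  have "gromov_product cone_dist (0, 0) (x n) (x n) = fst (x n)" for n
    using cone_region_nonneg[OF xF] by (simp add: gromov_product_cone cone_dist_same_ray)
  then show "\<exists>N. \<forall>n\<ge>N. C \<le> fst (x n)" using gp by metis
  obtain C where "\<And>u v. 0 \<le> fst u \<Longrightarrow> 0 \<le> fst v \<Longrightarrow> C \<le> gromov_product cone_dist (0, 0) u v
      \<Longrightarrow> \<bar>snd u - snd v\<bar> < pi"
    using large_gromov_product_close_angles[OF pi_gt_zero] by blast
  then show "\<exists>N. \<forall>m\<ge>N. \<forall>n\<ge>N. \<bar>snd (x m) - snd (x n)\<bar> < pi"
    using gp[of C] cone_region_nonneg[OF xF] by blast
qed

text \<open>The limit of the angles separates the boundary points of a sector.\<close>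

lemma gromov_E_cone_same_angle_limit:
  assumes "(x, y) \<in> (gromov_E (cone_region F) cone_dist (0, 0))\<^sup>+" "(\<lambda>n. snd (x n)) \<longlonglongrightarrow> a"
  shows "(\<lambda>n. snd (y n)) \<longlonglongrightarrow> a"
proof -
  have step: "(\<lambda>n. snd (y n)) \<longlonglongrightarrow> a"
    if xy: "(x, y) \<in> gromov_E (cone_region F) cone_dist (0, 0)" and x: "(\<lambda>n. snd (x n)) \<longlonglongrightarrow> a" for x y
  proof (rule LIMSEQ_I)
    fix e :: real assume "0 < e"
    then have e: "0 < e / 2" by simp
    have nn: "0 \<le> fst (x n)" "0 \<le> fst (y n)" for n
      using xy by (auto simp: gromov_E_iff gromov_sequences_iff intro!: cone_region_nonneg)
    obtain C where C: "\<And>u v. 0 \<le> fst u \<Longrightarrow> 0 \<le> fst v \<Longrightarrow> C \<le> gromov_product cone_dist (0, 0) u v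
        \<Longrightarrow> \<bar>snd u - snd v\<bar> < e / 2"
      using large_gromov_product_close_angles[OF e] by blast
    obtain N where N: "\<And>m n. N \<le> m \<Longrightarrow> N \<le> n \<Longrightarrow> C \<le> gromov_product cone_dist (0, 0) (x m) (y n)"
      using xy unfolding gromov_E_iff by blast
    obtain N' where N': "\<And>n. N' \<le> n \<Longrightarrow> norm (snd (x n) - a) < e / 2"
      using LIMSEQ_D[OF x e] by blast
    have "norm (snd (y n) - a) < e" if "max N N' \<le> n" for n
      using C[OF nn N, of n n] N'[of n] that by (simp add: abs_if split: if_splits)
    then show "\<exists>N. \<forall>n\<ge>N. norm (snd (y n) - a) < e" by blast
  qed
  show ?thesis using assms by (induction rule: trancl_induct) (auto intro: step)
qed

section \<open>An unbounded space with empty boundaries\<close>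

text \<open>The angles are the multiples of \<open>pi\<close>, and the ray of angle \<open>\<theta>\<close> has length \<open>\<theta>\<close>. Negative angles give no
points of positive radius.\<close>

definition hedgehog_rays :: "(real \<times> real) set" where
  "hedgehog_rays = {u. sin (snd u) = 0 \<and> fst u \<le> snd u}"

lemma closed_hedgehog_rays: "closed hedgehog_rays"
  unfolding hedgehog_rays_def
  by (intro closed_Collect_conj closed_Collect_eq closed_Collect_le continuous_intros)

lemma hedgehog_angles_far_apart:
  assumes "sin a = 0" "sin b = 0" "a \<noteq> b"
  shows "pi \<le> \<bar>a - b\<bar>"
proof (rule ccontr)
  assume "\<not> ?thesis"
  then have "0 < sin \<bar>a - b\<bar>" using assms(3) by (intro sin_gt_zero) auto
  moreover have "sin (a - b) = 0" using assms by (simp add: sin_diff)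
  ultimately show False by (simp add: abs_if sin_minus[of "a - b", simplified] split: if_splits)
qed

text \<open>Different angles are at least \<open>pi\<close> apart, so only combinations of points of one ray have to be
considered, and these lie between the two points.\<close>

lemma polar_convex_hedgehog_rays: "polar_convex hedgehog_rays"
  unfolding polar_convex_def
proof (rule conjI; clarify)
  fix r a s b \<rho> c \<alpha> \<beta> :: real
  assume in': "(r, a) \<in> hedgehog_rays" "(s, b) \<in> hedgehog_rays"
    and h: "0 < r" "0 < s" "0 < \<rho>" "a \<le> c" "c \<le> b" "b < a + pi" "0 \<le> \<alpha>" "0 \<le> \<beta>"
       "sinh \<rho> * cos c = \<alpha> * (sinh r * cos a) + \<beta> * (sinh s * cos b)"
       "sinh \<rho> * sin c = \<alpha> * (sinh r * sin a) + \<beta> * (sinh s * sin b)"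
       "cosh \<rho> = \<alpha> * cosh r + \<beta> * cosh s"
  have ab: "a = b" using hedgehog_angles_far_apart[of a b] in' h by (auto simp: hedgehog_rays_def)
  then have c: "c = a" using h by simp
  have "cos a \<noteq> 0" using in' sin_cos_squared_add[of a] by (auto simp: hedgehog_rays_def)
  then have S: "sinh \<rho> = \<alpha> * sinh r + \<beta> * sinh s"
    using h(9) unfolding c ab[symmetric]
    by (metis distrib_right mult.assoc mult_right_cancel)
  \<comment> \<open>The radius of the combination is at most the larger of the two radii, because the subtraction formula for
    \<open>sinh (\<rho> - m)\<close> is linear in \<open>sinh \<rho>\<close> and \<open>cosh \<rho>\<close>.\<close>
  define m where "m = max r s"
  have "\<alpha> * sinh (r - m) + \<beta> * sinh (s - m) \<le> 0"
    using h(7,8) by (intro add_nonpos_nonpos mult_nonneg_nonpos) (auto simp: m_def)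
  then have "sinh (\<rho> - m) \<le> 0"
    unfolding sinh_diff S h(11) by (simp add: algebra_simps)
  then have "\<rho> \<le> m" by simp
  then show "(\<rho>, c) \<in> hedgehog_rays" using in' c ab by (auto simp: hedgehog_rays_def m_def)
qed (auto simp: hedgehog_rays_def)

proposition hedgehog_boundaries_empty:
  assumes w: "w \<in> cone_region hedgehog_rays"
  shows "gromov_boundary (cone_region hedgehog_rays) cone_dist w = {}"
    and "end_boundary (cone_region hedgehog_rays) cone_dist w = {}"
proof -
  interpret Metric_space "cone_region hedgehog_rays" cone_dist by (rule Metric_space_cone_region)
  have "x \<notin> gromov_sequences (cone_region hedgehog_rays) cone_dist w" for x
  proof
    assume x: "x \<in> gromov_sequences (cone_region hedgehog_rays) cone_dist w"
    note X = gromov_sequences_cone_region[OF w x]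
    obtain N where N: "\<And>m n. N \<le> m \<Longrightarrow> N \<le> n \<Longrightarrow> \<bar>snd (x m) - snd (x n)\<bar> < pi" using X(3) by blast
    obtain N' where N': "\<And>n. N' \<le> n \<Longrightarrow> max 1 (snd (x N) + pi) \<le> fst (x n)" using X(2) by blast
    define n where "n = max N N'"
    have "max 1 (snd (x N) + pi) \<le> fst (x n)" "\<bar>snd (x N) - snd (x n)\<bar> < pi"
      using N N' by (auto simp: n_def)
    then show False using X(1)[of n] by (auto simp: cone_region_def hedgehog_rays_def)
  qed
  then show "gromov_boundary (cone_region hedgehog_rays) cone_dist w = {}"
    by (auto simp: gromov_boundary_def quotient_def)
  show "end_boundary (cone_region hedgehog_rays) cone_dist w = {}"
  proof (rule ccontr)
    assume "\<not> ?thesis"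
    then obtain U where U: "U \<in> end_boundary (cone_region hedgehog_rays) cone_dist w" by blast
    have far: "real n - fst w \<le> fst u" if "1 \<le> n" "u \<in> U n" for n u
      using end_boundary_outside_ball[OF U that w] cone_dist_le_radii_sum[OF w, of u] by simp
    obtain n :: nat where n: "max 1 (fst w) < real n" using reals_Archimedean2 by blast
    then have n1: "1 \<le> n" by simp
    obtain u where u: "u \<in> U n" using end_boundary_connectedin(2)[OF U n1] by blast
    have same_ray: "snd v = snd u" if "v \<in> U n" for v
    proof -
      have "snd v \<in> {snd u}"
      proof (rule connectedin_avoiding_apex_one_side[OF end_boundary_connectedin(1)[OF U n1]])
        show "(0, 0) \<notin> U n" using far[OF n1] n by force
      qed (use u that hedgehog_angles_far_apart in \<open>auto simp: hedgehog_rays_def\<close>)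
      then show ?thesis by simp
    qed
    obtain k :: nat where k: "max (real n) (fst w + \<bar>snd u\<bar>) < real k" using reals_Archimedean2 by blast
    then have kn: "1 \<le> k" "n \<le> k" using n1 by auto
    obtain v where v: "v \<in> U k" using end_boundary_connectedin(2)[OF U kn(1)] by blast
    have "v \<in> U n" using end_boundary_nested[OF U n1 kn(2)] v by blast
    then have "snd v = snd u" by (rule same_ray)
    moreover have "v \<in> cone_region hedgehog_rays" using end_boundary_outside_ball[OF U kn(1) v w] by simp
    moreover have "\<bar>snd u\<bar> < fst v" using far[OF kn(1) v] k by simp
    ultimately show False by (auto simp: cone_region_def hedgehog_rays_def)
  qed
qed

lemma not_mbounded_cone_region:
  assumes "\<And>C. \<exists>u\<in>F. C < fst u"
  shows "\<not> Metric_space.mbounded (cone_region F) cone_dist (cone_region F)"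
proof
  interpret Metric_space "cone_region F" cone_dist by (rule Metric_space_cone_region)
  assume "mbounded (cone_region F)"
  then obtain B where B: "\<forall>x\<in>cone_region F. \<forall>y\<in>cone_region F. cone_dist x y \<le> B"
    unfolding mbounded_alt by blast
  obtain u where u: "u \<in> F" "max 0 B < fst u" using assms by blast
  then have "u \<in> cone_region F" by (simp add: cone_region_def)
  then have "cone_dist u (0, 0) \<le> B" using B apex_in_cone_region by blast
  then show False using u cone_dist_apex[of u 0] by simp
qed

lemma hedgehog_rays_unbounded: "\<exists>u\<in>hedgehog_rays. C < fst u"
proof -
  obtain n :: nat where n: "C / pi < real n" using reals_Archimedean2 by blast
  have "(real n * pi, real n * pi) \<in> hedgehog_rays" by (simp add: hedgehog_rays_def)
  moreover have "C < fst (real n * pi, real n * pi)" using n by (simp add: field_simps)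
  ultimately show ?thesis by blast
qed

section \<open>A fan and a spiral with a common apex\<close>

text \<open>In the Klein model, with radial coordinate \<open>tanh r\<close>, each \<open>\<tau>\<close> cuts off the half-plane orthogonal to the ray
of angle \<open>\<tau>\<close> at distance \<open>\<tau>\<close> from the apex. As an intersection of complements of half-planes the region
is convex, and the cuts recede from the apex as the angle grows.\<close>

definition spiral :: "(real \<times> real) set" where
  "spiral = {u. 0 \<le> snd u \<and>
     (\<forall>\<tau>\<ge>0. \<bar>snd u - \<tau>\<bar> < pi / 2 \<longrightarrow> tanh (fst u) * cos (snd u - \<tau>) \<le> tanh \<tau>)}"

text \<open>The angles of the two parts are at least \<open>4 > pi\<close> apart, so the parts meet only in the apex.\<close>

definition fan_and_spiral :: "(real \<times> real) set" where
  "fan_and_spiral = {u. - 5 \<le> snd u \<and> snd u \<le> - 4} \<union> spiral"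

lemma closed_spiral: "closed spiral"
proof -
  have "spiral = {u. 0 \<le> snd u} \<inter>
     (\<Inter>\<tau>\<in>{0..}. {u. pi / 2 \<le> \<bar>snd u - \<tau>\<bar>} \<union> {u. tanh (fst u) * cos (snd u - \<tau>) \<le> tanh \<tau>})"
    by (force simp: spiral_def simp flip: not_less)
  also have "closed \<dots>"
    by (intro closed_Int closed_INT ballI closed_Un closed_Collect_le continuous_intros) auto
  finally show ?thesis .
qed

lemma closed_fan_and_spiral: "closed fan_and_spiral"
  unfolding fan_and_spiral_def
  by (intro closed_Un closed_spiral closed_Collect_conj closed_Collect_le continuous_intros)

text \<open>The cut with \<open>\<tau>\<close> equal to the angle of the point.\<close>

lemma spiral_radius_le:
  assumes "u \<in> spiral"
  shows "fst u \<le> snd u"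
proof -
  have "tanh (fst u) * cos (snd u - snd u) \<le> tanh (snd u)"
    using assms unfolding spiral_def mem_Collect_eq by (metis abs_zero diff_self half_gt_zero pi_gt_zero)
  then show ?thesis by simp
qed

text \<open>Only cuts with \<open>\<tau> > a - pi / 2\<close> concern the angle \<open>a\<close>, and they have distance more than \<open>r\<close> from the apex.\<close>

lemma small_radius_in_spiral:
  assumes "0 \<le> r" "r + 2 \<le> a"
  shows "(r, a) \<in> spiral"
proof -
  have "tanh r * cos (a - \<tau>) \<le> tanh \<tau>" if "\<bar>a - \<tau>\<bar> < pi / 2" for \<tau>
  proof -
    have "tanh r * cos (a - \<tau>) \<le> tanh r * 1" using assms by (intro mult_left_mono) auto
    also have "r \<le> \<tau>" using assms that pi_half_less_two by linarith
    then have "tanh r * 1 \<le> tanh \<tau>" by simp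
    finally show ?thesis .
  qed
  then show ?thesis using assms by (simp add: spiral_def)
qed

text \<open>Two points at angles less than \<open>pi\<close> apart lie in the same part. In the spiral, each cut is a linear
inequality in the hyperboloid model and passes to combinations with nonnegative coefficients.\<close>

lemma polar_convex_fan_and_spiral: "polar_convex fan_and_spiral"
  unfolding polar_convex_def
proof (rule conjI; clarify)
  fix r a s :: real
  assume ra: "(r, a) \<in> fan_and_spiral" and s: "0 < s" "s \<le> r"
  show "(s, a) \<in> fan_and_spiral"
  proof (cases "(r, a) \<in> spiral")
    case False
    then show ?thesis using ra by (auto simp: fan_and_spiral_def)
  next
    case True
    have "tanh s * cos (a - \<tau>) \<le> tanh \<tau>" if "0 \<le> \<tau>" "\<bar>a - \<tau>\<bar> < pi / 2" for \<tau>
    proof -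
      have "0 < cos (a - \<tau>)" by (rule cos_gt_zero_pi) (use that in linarith)+
      then have "tanh s * cos (a - \<tau>) \<le> tanh r * cos (a - \<tau>)" using s by (intro mult_right_mono) auto
      also have "\<dots> \<le> tanh \<tau>" using True that by (auto simp: spiral_def)
      finally show ?thesis .
    qed
    moreover have "0 \<le> a" using True by (simp add: spiral_def)
    ultimately have "(s, a) \<in> spiral" by (simp add: spiral_def)
    then show ?thesis by (simp add: fan_and_spiral_def)
  qed
next
  fix r a s b \<rho> c \<alpha> \<beta> :: real
  assume in': "(r, a) \<in> fan_and_spiral" "(s, b) \<in> fan_and_spiral"
    and h: "0 < r" "0 < s" "0 < \<rho>" "a \<le> c" "c \<le> b" "b < a + pi" "0 \<le> \<alpha>" "0 \<le> \<beta>"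
       "sinh \<rho> * cos c = \<alpha> * (sinh r * cos a) + \<beta> * (sinh s * cos b)"
       "sinh \<rho> * sin c = \<alpha> * (sinh r * sin a) + \<beta> * (sinh s * sin b)"
       "cosh \<rho> = \<alpha> * cosh r + \<beta> * cosh s"
  consider "- 5 \<le> a" "b \<le> - 4" | "(r, a) \<in> spiral" "(s, b) \<in> spiral"
  proof -
    have "0 \<le> d" if "(q, d) \<in> spiral" for q d
      using that by (simp add: spiral_def)
    moreover have "(- 5 \<le> a \<and> a \<le> - 4) \<or> (r, a) \<in> spiral"
      "(- 5 \<le> b \<and> b \<le> - 4) \<or> (s, b) \<in> spiral"
      using in' by (simp_all add: fan_and_spiral_def)
    moreover have "a \<le> b" "b < a + 4" using h pi_less_4 by linarith+
    ultimately show ?thesis using that by (smt (verit))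
  qed
  then show "(\<rho>, c) \<in> fan_and_spiral"
  proof cases
    case 1
    then show ?thesis using h by (auto simp: fan_and_spiral_def)
  next
    case 2
    have "tanh \<rho> * cos (c - \<tau>) \<le> tanh \<tau>" if \<tau>: "0 \<le> \<tau>" "\<bar>c - \<tau>\<bar> < pi / 2" for \<tau>
    proof -
      \<comment> \<open>At an end of angle \<open>d\<close> that does not see the cut the inequality still holds, since \<open>d - \<tau>\<close> is then
        between \<open>pi / 2\<close> and \<open>3 * pi / 2\<close> in absolute value and the cosine is not positive.\<close>
      have ends: "sinh q * cos (d - \<tau>) \<le> tanh \<tau> * cosh q"
        if q: "(q, d) \<in> spiral" "0 < q" "\<bar>d - c\<bar> < pi" for q d
      proof (cases "\<bar>d - \<tau>\<bar> < pi / 2")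
        case True
        then have "tanh q * cos (d - \<tau>) \<le> tanh \<tau>" using q \<tau> by (auto simp: spiral_def)
        then have "tanh q * cos (d - \<tau>) * cosh q \<le> tanh \<tau> * cosh q" by (intro mult_right_mono) auto
        then show ?thesis by (simp add: tanh_def)
      next
        case False
        have "cos (pi - \<bar>d - \<tau>\<bar>) \<ge> 0"
          by (rule cos_ge_zero) (use False q(3) \<tau>(2) in linarith)+
        then have "cos (d - \<tau>) \<le> 0" by (simp add: cos_diff[of pi])
        then have "sinh q * cos (d - \<tau>) \<le> 0" using q by (intro mult_nonneg_nonpos) auto
        also have "0 \<le> tanh \<tau> * cosh q" using \<tau> by simp
        finally show ?thesis .
      qed
      have "sinh \<rho> * cos (c - \<tau>) = (sinh \<rho> * cos c) * cos \<tau> + (sinh \<rho> * sin c) * sin \<tau>"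
        by (simp add: cos_diff algebra_simps)
      also have "\<dots> = \<alpha> * (sinh r * cos (a - \<tau>)) + \<beta> * (sinh s * cos (b - \<tau>))"
        unfolding h(9,10) by (simp add: cos_diff algebra_simps)
      also have "\<dots> \<le> \<alpha> * (tanh \<tau> * cosh r) + \<beta> * (tanh \<tau> * cosh s)"
        using 2 h by (intro add_mono mult_left_mono ends) auto
      also have "\<dots> = tanh \<tau> * cosh \<rho>" unfolding h(11) by (simp add: algebra_simps)
      finally show ?thesis by (simp add: tanh_def[of \<rho>] divide_le_eq)
    qed
    moreover have "0 \<le> c" using 2(1) h by (simp add: spiral_def)
    ultimately have "(\<rho>, c) \<in> spiral" by (simp add: spiral_def)
    then show ?thesis by (simp add: fan_and_spiral_def)
  qed
qed

definition ray :: "real \<Rightarrow> nat \<Rightarrow> real \<times> real" where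
  "ray a n = (real n + 1, a)"

lemma ray_in_gromov_sequences:
  assumes "\<And>n. ray a n \<in> F"
  shows "ray a \<in> gromov_sequences (cone_region F) cone_dist (0, 0)"
  unfolding gromov_sequences_iff
proof (intro conjI allI)
  show "range (ray a) \<subseteq> cone_region F" using assms by (auto simp: cone_region_def ray_def)
  fix C
  obtain N :: nat where N: "C \<le> real N" using real_arch_simple by blast
  have "C \<le> gromov_product cone_dist (0, 0) (ray a m) (ray a n)" if "N \<le> m" "N \<le> n" for m n
    using N that by (simp add: gromov_product_cone ray_def cone_dist_same_ray)
  then show "\<exists>N. \<forall>m\<ge>N. \<forall>n\<ge>N. C \<le> gromov_product cone_dist (0, 0) (ray a m) (ray a n)" by blast
qed

lemma distinct_rays_distinct_boundary_points:
  assumes "\<And>n. ray a n \<in> F" "\<And>n. ray b n \<in> F" "a \<noteq> b"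
  obtains \<xi> \<eta> where "\<xi> \<in> gromov_boundary (cone_region F) cone_dist (0, 0)"
    "\<eta> \<in> gromov_boundary (cone_region F) cone_dist (0, 0)" "\<xi> \<noteq> \<eta>"
proof
  define E where "E = (gromov_E (cone_region F) cone_dist (0, 0))\<^sup>+"
  note r = ray_in_gromov_sequences[OF assms(1)] ray_in_gromov_sequences[OF assms(2)]
  show "E `` {ray a} \<in> gromov_boundary (cone_region F) cone_dist (0, 0)"
    "E `` {ray b} \<in> gromov_boundary (cone_region F) cone_dist (0, 0)"
    unfolding gromov_boundary_def E_def by (intro quotientI r)+
  have "(ray b, ray b) \<in> E"
    using r(2) by (auto simp: E_def gromov_E_iff gromov_sequences_iff)
  moreover have "(ray a, ray b) \<notin> E"
  proof
    assume "(ray a, ray b) \<in> E"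
    then have "(\<lambda>n. snd (ray b n)) \<longlonglongrightarrow> a"
      unfolding E_def by (rule gromov_E_cone_same_angle_limit) (simp add: ray_def)
    then show False using assms(3) by (simp add: ray_def LIMSEQ_const_iff)
  qed
  ultimately show "E `` {ray a} \<noteq> E `` {ray b}" by blast
qed

lemma fan_and_spiral_gap:
  assumes "u \<in> fan_and_spiral" "v \<in> fan_and_spiral" "snd u < 0" "\<not> snd v < 0"
  shows "pi \<le> \<bar>snd u - snd v\<bar>"
proof -
  have "snd u \<le> - 4" using assms by (auto simp: fan_and_spiral_def spiral_def)
  then show ?thesis using assms(4) pi_less_4 by linarith
qed

text \<open>From some index \<open>N\<close> on, all angles are within \<open>pi\<close> of \<open>snd (x N)\<close>. In the spiral this bounds the radii,
but radii tend to infinity.\<close>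

lemma gromov_sequence_eventually_in_fan:
  assumes w: "w \<in> cone_region fan_and_spiral"
    and x: "x \<in> gromov_sequences (cone_region fan_and_spiral) cone_dist w"
  shows "\<exists>N. \<forall>n\<ge>N. C < fst (x n) \<and> - 5 \<le> snd (x n) \<and> snd (x n) \<le> - 4"
proof -
  note X = gromov_sequences_cone_region[OF w x]
  obtain N where N: "\<And>m n. N \<le> m \<Longrightarrow> N \<le> n \<Longrightarrow> \<bar>snd (x m) - snd (x n)\<bar> < pi" using X(3) by blast
  obtain N' where N': "\<And>n. N' \<le> n \<Longrightarrow> max (max 1 (C + 1)) (snd (x N) + pi) \<le> fst (x n)"
    using X(2) by blast
  have "C < fst (x n) \<and> - 5 \<le> snd (x n) \<and> snd (x n) \<le> - 4" if "max N N' \<le> n" for n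
  proof -
    have n: "max (max 1 (C + 1)) (snd (x N) + pi) \<le> fst (x n)" "\<bar>snd (x N) - snd (x n)\<bar> < pi"
      using N[of N n] N'[of n] that by auto
    then have "x n \<in> fan_and_spiral" using X(1)[of n] by (auto simp: cone_region_def)
    moreover have "x n \<notin> spiral" using spiral_radius_le n by fastforce
    ultimately show ?thesis using n by (auto simp: fan_and_spiral_def)
  qed
  then show ?thesis by blast
qed

text \<open>All points of the Gromov boundary go to the end \<open>V\<close> of the fan. The two sides of the fan give two boundary
points, and the end \<open>U\<close> of the spiral is missed. The ends differ because a component far from \<open>w\<close> does not
contain the apex and lies in only one of the two parts.\<close>

proposition fan_and_spiral_natural_map:
  assumes w: "w \<in> cone_region fan_and_spiral"
  defines "X \<equiv> cone_region fan_and_spiral"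
  shows "\<not> inj_on (natural_map X cone_dist w) (gromov_boundary X cone_dist w)"
    and "\<not> end_boundary X cone_dist w \<subseteq> natural_map X cone_dist w ` gromov_boundary X cone_dist w"
proof -
  interpret Metric_space X cone_dist unfolding X_def by (rule Metric_space_cone_region)
  have wX: "w \<in> X" using w by (simp add: X_def)
  have w0: "0 \<le> fst w" using cone_region_nonneg[OF w] .
  define fan_tail where "fan_tail n = {fst w + real n<..} \<times> {- 5..- 4 :: real}" for n :: nat
  define spiral_tail where "spiral_tail n = (\<lambda>r. (r, r + 2)) ` {fst w + real n<..}" for n :: nat
  have fan_sub: "fan_tail n \<subseteq> X" and spiral_sub: "spiral_tail n \<subseteq> X" for n
    using w0 small_radius_in_spiral
    by (auto simp: fan_tail_def spiral_tail_def X_def cone_region_def fan_and_spiral_def)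
  have far: "real n < cone_dist w u" if "u \<in> X" "fst w + real n < fst u" for u n
    using cone_dist_ge_radii_diff[OF w, of u] that by (simp add: X_def)
  obtain V where V: "V \<in> end_boundary X cone_dist w" "\<And>n. 1 \<le> n \<Longrightarrow> fan_tail n \<subseteq> V n"
  proof -
    have "\<exists>V\<in>end_boundary X cone_dist w. \<forall>n\<ge>1. fan_tail n \<subseteq> V n"
    proof (rule end_of_tails[OF wX])
      fix n :: nat
      have "connected (fan_tail n)"
        unfolding fan_tail_def by (intro convex_connected convex_Times) auto
      then show "connectedin mtopology (fan_tail n)"
        using connectedin_cone_region fan_sub unfolding X_def by blast
      have "(fst w + real n + 1, - 4) \<in> fan_tail n" by (simp add: fan_tail_def)
      then show "fan_tail n \<noteq> {}" by blast
      show "fan_tail (Suc n) \<subseteq> fan_tail n" by (auto simp: fan_tail_def)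
      show "real n < cone_dist w u" if "u \<in> fan_tail n" for u
        using fan_sub that by (intro far) (auto simp: fan_tail_def)
    qed
    then show ?thesis using that by blast
  qed
  obtain U where U: "U \<in> end_boundary X cone_dist w" "\<And>n. 1 \<le> n \<Longrightarrow> spiral_tail n \<subseteq> U n"
  proof -
    have "\<exists>U\<in>end_boundary X cone_dist w. \<forall>n\<ge>1. spiral_tail n \<subseteq> U n"
    proof (rule end_of_tails[OF wX])
      fix n :: nat
      have "connected (spiral_tail n)"
        unfolding spiral_tail_def by (intro connected_continuous_image continuous_intros) auto
      then show "connectedin mtopology (spiral_tail n)"
        using connectedin_cone_region spiral_sub unfolding X_def by blast
      show "spiral_tail n \<noteq> {}" by (simp add: spiral_tail_def)
      show "spiral_tail (Suc n) \<subseteq> spiral_tail n" by (auto simp: spiral_tail_def)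
      show "real n < cone_dist w u" if "u \<in> spiral_tail n" for u
        using spiral_sub that by (intro far) (auto simp: spiral_tail_def)
    qed
    then show ?thesis using that by blast
  qed
  have nat_map: "natural_map X cone_dist w \<xi> = V" if \<xi>: "\<xi> \<in> gromov_boundary X cone_dist w" for \<xi>
  proof (rule natural_map_eqI[OF V(1)])
    show "\<xi> \<noteq> {}" using gromov_boundary_elem(2)[OF \<xi>] .
    fix x m assume x: "x \<in> \<xi>" and m: "1 \<le> (m::nat)"
    have "x \<in> gromov_sequences X cone_dist w" using gromov_boundary_elem(1)[OF \<xi>] x by blast
    then obtain N where "\<forall>n\<ge>N. fst w + real m < fst (x n) \<and> - 5 \<le> snd (x n) \<and> snd (x n) \<le> - 4"
      using gromov_sequence_eventually_in_fan[OF w] unfolding X_def by blast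
    then have "\<forall>n\<ge>N. x n \<in> fan_tail m" by (simp add: fan_tail_def mem_Times_iff)
    then show "\<exists>N. \<forall>n\<ge>N. x n \<in> V m" using V(2)[OF m] by blast
  qed
  have ray: "ray a n \<in> fan_and_spiral" if "- 5 \<le> a" "a \<le> - 4" for a n
    using that by (simp add: ray_def fan_and_spiral_def)
  obtain \<xi> \<eta> where \<xi>\<eta>: "\<xi> \<in> gromov_boundary X cone_dist (0, 0)"
    "\<eta> \<in> gromov_boundary X cone_dist (0, 0)" "\<xi> \<noteq> \<eta>"
    using distinct_rays_distinct_boundary_points[of "- 5" fan_and_spiral "- 4"] ray
    unfolding X_def by auto
  have "gromov_boundary X cone_dist (0, 0) = gromov_boundary X cone_dist w"
    by (rule gromov_boundary_basepoint[OF _ wX]) (simp add: X_def apex_in_cone_region)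
  then show "\<not> inj_on (natural_map X cone_dist w) (gromov_boundary X cone_dist w)"
    using \<xi>\<eta> nat_map by (metis inj_onD)
  have "U \<noteq> V"
  proof
    assume eq: "U = V"
    obtain n :: nat where n: "max 1 (fst w) < real n" using reals_Archimedean2 by blast
    then have n1: "1 \<le> n" by simp
    have apex: "(0, 0) \<notin> V n"
    proof
      assume "(0, 0) \<in> V n"
      then have "real n \<le> cone_dist w (0, 0)" using end_boundary_outside_ball(2)[OF V(1) n1 _ wX] by blast
      then show False using n w0 by (simp add: cone_dist_apex)
    qed
    define r where "r = fst w + real n + 1"
    have f: "(r, - 4) \<in> V n" using V(2)[OF n1] by (auto simp: fan_tail_def r_def)
    have "(r, r + 2) \<in> spiral_tail n"
      unfolding spiral_tail_def by (rule image_eqI[of _ _ r]) (simp_all add: r_def)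
    then have s: "(r, r + 2) \<in> V n" using U(2)[OF n1] eq by blast
    have "snd (r, r + 2) \<in> {..<0}"
      by (rule connectedin_avoiding_apex_one_side[OF
            end_boundary_connectedin(1)[OF V(1) n1, unfolded X_def] apex _ f s])
        (use fan_and_spiral_gap in auto)
    then show False using w0 by (simp add: r_def)
  qed
  then show "\<not> end_boundary X cone_dist w \<subseteq> natural_map X cone_dist w ` gromov_boundary X cone_dist w"
    using U(1) nat_map by blast
qed

theorem theorem1p2:
  "(\<exists>(X :: (real \<times> real) set) d.
      CAT_minus_1 X d \<and> Metric_space.mcomplete X d \<and> X \<noteq> {} \<and>
      (\<forall>w\<in>X. \<not> inj_on (natural_map X d w) (gromov_boundary X d w) \<and>
             \<not> end_boundary X d w \<subseteq> natural_map X d w ` gromov_boundary X d w)) \<and>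
   (\<exists>(Y :: (real \<times> real) set) d.
      CAT_minus_1 Y d \<and> Metric_space.mcomplete Y d \<and> \<not> Metric_space.mbounded Y d Y \<and>
      (\<forall>w\<in>Y. gromov_boundary Y d w = {} \<and> end_boundary Y d w = {}))"
proof (rule conjI)
  have "cone_region fan_and_spiral \<noteq> {}" using apex_in_cone_region by blast
  then show "\<exists>(X :: (real \<times> real) set) d.
      CAT_minus_1 X d \<and> Metric_space.mcomplete X d \<and> X \<noteq> {} \<and>
      (\<forall>w\<in>X. \<not> inj_on (natural_map X d w) (gromov_boundary X d w) \<and>
             \<not> end_boundary X d w \<subseteq> natural_map X d w ` gromov_boundary X d w)"
    using CAT_minus_1_cone_region[OF polar_convex_fan_and_spiral]
      mcomplete_cone_region[OF closed_fan_and_spiral] fan_and_spiral_natural_map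
    by (intro exI[of _ "cone_region fan_and_spiral"] exI[of _ cone_dist] conjI ballI)
  show "\<exists>(Y :: (real \<times> real) set) d.
      CAT_minus_1 Y d \<and> Metric_space.mcomplete Y d \<and> \<not> Metric_space.mbounded Y d Y \<and>
      (\<forall>w\<in>Y. gromov_boundary Y d w = {} \<and> end_boundary Y d w = {})"
    using CAT_minus_1_cone_region[OF polar_convex_hedgehog_rays]
      mcomplete_cone_region[OF closed_hedgehog_rays]
      not_mbounded_cone_region[OF hedgehog_rays_unbounded] hedgehog_boundaries_empty
    by (intro exI[of _ "cone_region hedgehog_rays"] exI[of _ cone_dist] conjI ballI)
qed

end
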